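(* $\textsc{QuadRLE}$ polynomial-time reduces to $\textsc{CRLE}$. More precisely, given posets $P_i=(X_i,\prec_i)$ on $n_i=|X_i|$ elements and $x_i\in\min(P_i)$, $1\le i\le4$, one can construct in polynomial time a poset $P=(X,\prec)$ on $n=|X|\le n_1+\max\{n_2,n_3\}+1$ elements with $x\in\min(P)$ and a poset $Q=(Y,\prec')$ on $m=|Y|\le n_4+\max\{n_2,n_3\}+1$ elements with $y\in\min(Q)$, such that $\rho(P,x)=\rho(Q,y)$ if and only if $\rho(P_1,x_1)\rho(P_2,x_2)=\rho(P_3,x_3)\rho(P_4,x_4)$.
   Context: For a finite poset $P$, $e(P)$ is its number of linear extensions; for a minimal element $x$ of $P$, $\rho(P,x):=e(P)/e(P-x)$, where $P-x$ is the subposet on $X\setminus\{x\}$. $\textsc{QuadRLE}$ asks whether $\rho(P_1,x_1)\rho(P_2,x_2)=\rho(P_3,x_3)\rho(P_4,x_4)$; $\textsc{CRLE}$ asks whether $\rho(P,x)=\rho(Q,y)$. *)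

theory Defs
  imports Complex_Main "HOL-Library.FuncSet" "HOL-Computational_Algebra.Polynomial"
begin

section \<open>Finite posets and linear extensions\<close>

text \<open>A poset is a pair of a ground set and a strict order relation on it.\<close>

type_synonym 'a poset = "'a set \<times> ('a \<times> 'a) set"

definition finite_poset :: "'a poset \<Rightarrow> bool" where
  "finite_poset = (\<lambda>(X, r). finite X \<and> r \<subseteq> X \<times> X \<and> irrefl r \<and> trans r)"

definition linear_extensions :: "'a poset \<Rightarrow> ('a \<Rightarrow> nat) set" where
  "linear_extensions = (\<lambda>(X, r).
     {f \<in> X \<rightarrow>\<^sub>E {1..card X}. bij_betw f X {1..card X} \<and> (\<forall>(a, b) \<in> r. f a < f b)})"

definition num_ext :: "'a poset \<Rightarrow> nat" where
  "num_ext P = card (linear_extensions P)"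

definition min_elems :: "'a poset \<Rightarrow> 'a set" where
  "min_elems = (\<lambda>(X, r). {x \<in> X. \<forall>a \<in> X. (a, x) \<notin> r})"

definition delete :: "'a poset \<Rightarrow> 'a \<Rightarrow> 'a poset" where
  "delete = (\<lambda>(X, r) x. (X - {x}, Restr r (X - {x})))"

definition rho :: "'a poset \<Rightarrow> 'a \<Rightarrow> rat" where
  "rho P x = of_nat (num_ext P) / of_nat (num_ext (delete P x))"


section \<open>Polynomial time\<close>

text \<open>
  The machine model is a random access machine with unbounded registers holding natural
  numbers, indirect addressing, a random-access read-only input word and an append-only
  output word, programmed with structured control flow. Every instruction and every test
  has unit cost. The only arithmetic operations are addition and truncated subtraction, so
  that t steps produce numbers of at most O(t) bits beyond those of the input length and of
  the constants in the program; polynomial time on this machine is therefore the same as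
  polynomial time on Turing machines.
\<close>

datatype prog =
    Const nat nat
  | Move nat nat
  | Add nat nat nat
  | Sub nat nat nat
  | Load nat nat
  | Store nat nat
  | Read nat nat
  | Emit bool
  | Seq prog prog
  | IfNZ nat prog prog
  | WhileNZ nat prog

type_synonym state = "(nat \<Rightarrow> nat) \<times> bool list"

text \<open>Reading past the end of the input yields 2, which lets a program detect the end.\<close>

definition input_symbol :: "bool list \<Rightarrow> nat \<Rightarrow> nat" where
  "input_symbol w i = (if i < length w then of_bool (w ! i) else 2)"

text \<open>\<open>exec w c s t s'\<close>: on input \<open>w\<close>, program \<open>c\<close> started in state \<open>s\<close> halts in state \<open>s'\<close>
  after exactly \<open>t\<close> steps.\<close>

inductive exec :: "bool list \<Rightarrow> prog \<Rightarrow> state \<Rightarrow> nat \<Rightarrow> state \<Rightarrow> bool" for w where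
  Const: "exec w (Const i k) (R, u) 1 (R(i := k), u)"
| Move: "exec w (Move i j) (R, u) 1 (R(i := R j), u)"
| Add: "exec w (Add i j k) (R, u) 1 (R(i := R j + R k), u)"
| Sub: "exec w (Sub i j k) (R, u) 1 (R(i := R j - R k), u)"
| Load: "exec w (Load i j) (R, u) 1 (R(i := R (R j)), u)"
| Store: "exec w (Store i j) (R, u) 1 (R(R i := R j), u)"
| Read: "exec w (Read i j) (R, u) 1 (R(i := input_symbol w (R j)), u)"
| Emit: "exec w (Emit b) (R, u) 1 (R, u @ [b])"
| Seq: "exec w c1 s t1 s' \<Longrightarrow> exec w c2 s' t2 s'' \<Longrightarrow> exec w (Seq c1 c2) s (t1 + t2) s''"
| IfNZ_True: "R i \<noteq> 0 \<Longrightarrow> exec w c1 (R, u) t s' \<Longrightarrow> exec w (IfNZ i c1 c2) (R, u) (t + 1) s'"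
| IfNZ_False: "R i = 0 \<Longrightarrow> exec w c2 (R, u) t s' \<Longrightarrow> exec w (IfNZ i c1 c2) (R, u) (t + 1) s'"
| WhileNZ_False: "R i = 0 \<Longrightarrow> exec w (WhileNZ i c) (R, u) 1 (R, u)"
| WhileNZ_True: "R i \<noteq> 0 \<Longrightarrow> exec w c (R, u) t1 s' \<Longrightarrow> exec w (WhileNZ i c) s' t2 s''
    \<Longrightarrow> exec w (WhileNZ i c) (R, u) (t1 + t2 + 1) s''"

definition runs_within :: "prog \<Rightarrow> bool list \<Rightarrow> bool list \<Rightarrow> nat \<Rightarrow> bool" where
  "runs_within c w v T \<longleftrightarrow> (\<exists>t \<le> T. \<exists>R. exec w c ((\<lambda>_. 0), []) t (R, v))"

definition polytime_computable ::
    "'i set \<Rightarrow> ('i \<Rightarrow> bool list) \<Rightarrow> ('j \<Rightarrow> bool list) \<Rightarrow> ('i \<Rightarrow> 'j) \<Rightarrow> bool" where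
  "polytime_computable D enc enc' F \<longleftrightarrow>
     (\<exists>c. \<exists>p :: nat poly. \<forall>a \<in> D. runs_within c (enc a) (enc' (F a)) (poly p (length (enc a))))"

text \<open>A decision problem consists of its instances, its yes-instances, and an encoding of
  instances as binary words.\<close>

record 'i problem =
  instances :: "'i set"
  yes_instances :: "'i set"
  encoding :: "'i \<Rightarrow> bool list"

definition polytime_reduction :: "'i problem \<Rightarrow> 'j problem \<Rightarrow> ('i \<Rightarrow> 'j) \<Rightarrow> bool" where
  "polytime_reduction A B F \<longleftrightarrow>
     (\<forall>a \<in> instances A. F a \<in> instances B \<and> (F a \<in> yes_instances B \<longleftrightarrow> a \<in> yes_instances A)) \<and>
     polytime_computable (instances A) (encoding A) (encoding B) F"

definition polytime_reducible :: "'i problem \<Rightarrow> 'j problem \<Rightarrow> bool" where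
  "polytime_reducible A B \<longleftrightarrow> (\<exists>F. polytime_reduction A B F)"


section \<open>The problems QuadRLE and CRLE\<close>

text \<open>Posets given to or produced by an algorithm have ground set \<open>{0, ..., n - 1}\<close>.\<close>

type_synonym pointed = "nat poset \<times> nat"

definition pointed_posets :: "pointed set" where
  "pointed_posets =
     {(P, x). finite_poset P \<and> fst P = {..<card (fst P)} \<and> x \<in> min_elems P}"

text \<open>The size in unary, the matrix of the order relation row by row, the element in unary.\<close>

definition encode_unary :: "nat \<Rightarrow> bool list" where
  "encode_unary k = replicate k True @ [False]"

definition encode_pointed :: "pointed \<Rightarrow> bool list" where
  "encode_pointed = (\<lambda>((X, r), x). let n = card X in
     encode_unary n @ concat (map (\<lambda>i. map (\<lambda>j. (i, j) \<in> r) [0..<n]) [0..<n]) @ encode_unary x)"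

definition QuadRLE :: "(pointed \<times> pointed \<times> pointed \<times> pointed) problem" where
  "QuadRLE = \<lparr>
     instances = pointed_posets \<times> pointed_posets \<times> pointed_posets \<times> pointed_posets,
     yes_instances = {((P1, x1), (P2, x2), (P3, x3), (P4, x4)).
       (P1, x1) \<in> pointed_posets \<and> (P2, x2) \<in> pointed_posets \<and>
       (P3, x3) \<in> pointed_posets \<and> (P4, x4) \<in> pointed_posets \<and>
       rho P1 x1 * rho P2 x2 = rho P3 x3 * rho P4 x4},
     encoding = (\<lambda>(a1, a2, a3, a4).
       encode_pointed a1 @ encode_pointed a2 @ encode_pointed a3 @ encode_pointed a4)\<rparr>"

definition CRLE :: "(pointed \<times> pointed) problem" where
  "CRLE = \<lparr>
     instances = pointed_posets \<times> pointed_posets,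
     yes_instances = {((P, x), (Q, y)).
       (P, x) \<in> pointed_posets \<and> (Q, y) \<in> pointed_posets \<and> rho P x = rho Q y},
     encoding = (\<lambda>(a, b). encode_pointed a @ encode_pointed b)\<rparr>"

end

theory Submission
  imports Defs
begin

text \<open>
  Given pointed posets \<open>(P1, x1)\<close> and \<open>(P2, x2)\<close> with \<open>t = rho P1 x1 * rho P2 x2\<close>, take the linear sum of
  the dual of \<open>P2\<close>, padded from below to \<open>N\<close> elements by a chain, and of \<open>P1\<close>, and drop the relation
  between \<open>x2\<close> and \<open>x1\<close>. In a linear extension either \<open>x2\<close> precedes \<open>x1\<close>, which gives
  \<open>e(P2) e(P1)\<close> possibilities, or \<open>x1\<close> and \<open>x2\<close> are adjacent in the middle, which gives
  \<open>e(P2 - x2) e(P1 - x1)\<close>. A new minimal element \<open>z\<close> below \<open>P1\<close> and incomparable to the other \<open>N\<close> elements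
  can be inserted at \<open>N + 1\<close> places in the first case and at \<open>N\<close> places in the second. Hence the
  relative number of linear extensions at \<open>z\<close> is \<open>N + t / (1 + t)\<close>, a strictly increasing
  function of \<open>t\<close>, and two such posets with the same \<open>N\<close> compare two products.
\<close>

section \<open>Counting linear extensions\<close>

text \<open>Only the ground set varies while \<open>r\<close> stays fixed, so inductions on the set
  leave the relation untouched. \<open>r\<close> may be any relation, so one comparison can be added
  without taking a transitive closure.\<close>

definition count_ext :: "('a \<times> 'a) set \<Rightarrow> 'a set \<Rightarrow> nat" where
  "count_ext r X = num_ext (X, Restr r X)"

lemma linear_extensions_Restr:
  "linear_extensions (X, Restr r X) =
    {f \<in> X \<rightarrow>\<^sub>E {1..card X}. bij_betw f X {1..card X} \<and> (\<forall>a\<in>X. \<forall>b\<in>X. (a, b) \<in> r \<longrightarrow> f a < f b)}"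
  unfolding linear_extensions_def by auto

lemma finite_linear_extensions: "finite X \<Longrightarrow> finite (linear_extensions (X, r))"
  unfolding linear_extensions_def
  by (auto intro!: finite_subset[OF _ finite_PiE[of X "\<lambda>_. {1..card X}"]])

lemma count_ext_empty [simp]: "count_ext r {} = 1"
proof -
  have "linear_extensions ({}, Restr r {}) = {\<lambda>x. undefined}"
    unfolding linear_extensions_Restr by (auto simp: bij_betw_def)
  then show ?thesis unfolding count_ext_def num_ext_def by simp
qed

text \<open>In a linear extension the element labelled \<open>card X\<close> is maximal, and
  deleting it leaves a linear extension of the rest. If nothing is maximal, both sides are 0. Most
  counting identities below are inductions along this recursion.\<close>

lemma count_ext_rec:
  assumes fin: "finite X" and ne: "X \<noteq> {}"
  shows "count_ext r X = (\<Sum>m | m \<in> X \<and> (\<forall>y\<in>X. (m, y) \<notin> r). count_ext r (X - {m}))"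
proof -
  define n where "n = card X"
  define M where "M = {m \<in> X. \<forall>y\<in>X. (m, y) \<notin> r}"
  define L where "L = (\<lambda>Y. linear_extensions (Y, Restr r Y))"
  have n: "n > 0" using fin ne by (simp add: n_def card_gt_0_iff)
  have cm: "card (X - {m}) = n - 1" if "m \<in> X" for m using that fin by (simp add: n_def)
  let ?ext = "\<lambda>(m, g :: 'a \<Rightarrow> nat). g(m := n)"
  let ?res = "\<lambda>f :: 'a \<Rightarrow> nat. (inv_into X f n, restrict f (X - {inv_into X f n}))"
  \<comment> \<open>\<open>?ext\<close> gives the new top \<open>m\<close> the label
    \<open>n\<close>; \<open>?res\<close> finds that top again and restores the value
    \<open>undefined\<close> there by restriction.\<close>
  have "bij_betw ?ext (SIGMA m:M. L (X - {m})) (L X)"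
  proof (rule bij_betw_byWitness[where f' = ?res])
    show "\<forall>p\<in>(SIGMA m:M. L (X - {m})). ?res (?ext p) = p"
    proof
      fix p assume "p \<in> (SIGMA m:M. L (X - {m}))"
      then obtain m g where p: "p = (m, g)" and m: "m \<in> M" and g: "g \<in> L (X - {m})" by auto
      have mX: "m \<in> X" using m by (simp add: M_def)
      have gP: "g \<in> (X - {m}) \<rightarrow>\<^sub>E {1..n - 1}"
        using g cm[OF mX] by (simp add: L_def linear_extensions_Restr)
      have ran: "g y < n" if "y \<in> X" "y \<noteq> m" for y
        using PiE_mem[OF gP, of y] that n by auto
      have uniq: "(g(m := n)) y = n \<longleftrightarrow> y = m" if "y \<in> X" for y
        using ran[of y] that by auto
      have "n \<in> (g(m := n)) ` X" using mX by (auto simp: image_iff)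
      then have "inv_into X (g(m := n)) n = m"
        using uniq inv_into_into[of n "g(m := n)" X] f_inv_into_f[of n "g(m := n)" X] by blast
      moreover have "restrict (g(m := n)) (X - {m}) = g"
        using gP by (auto simp: restrict_def PiE_def extensional_def fun_eq_iff)
      ultimately show "?res (?ext p) = p" by (simp add: p)
    qed
    show "\<forall>f\<in>L X. ?ext (?res f) = f"
    proof
      fix f assume f: "f \<in> L X"
      have fP: "f \<in> X \<rightarrow>\<^sub>E {1..n}" and fb: "bij_betw f X {1..n}"
        using f by (simp_all add: L_def linear_extensions_Restr n_def)
      have "n \<in> f ` X" using fb n by (simp add: bij_betw_def)
      then have "inv_into X f n \<in> X" "f (inv_into X f n) = n"
        by (simp_all add: inv_into_into f_inv_into_f)
      then show "?ext (?res f) = f"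
        using fP by (auto simp: restrict_def PiE_def extensional_def fun_eq_iff)
    qed
    show "?ext ` (SIGMA m:M. L (X - {m})) \<subseteq> L X"
    proof (rule image_subsetI)
      fix p assume "p \<in> (SIGMA m:M. L (X - {m}))"
      then obtain m g where p: "p = (m, g)" and m: "m \<in> M" and g: "g \<in> L (X - {m})" by auto
      have mX: "m \<in> X" using m by (simp add: M_def)
      have gP: "g \<in> (X - {m}) \<rightarrow>\<^sub>E {1..n - 1}" and gb: "bij_betw g (X - {m}) {1..n - 1}"
        and gr: "\<And>a b. a \<in> X \<Longrightarrow> b \<in> X \<Longrightarrow> a \<noteq> m \<Longrightarrow> b \<noteq> m \<Longrightarrow> (a, b) \<in> r \<Longrightarrow> g a < g b"
        using g cm[OF mX] by (simp_all add: L_def linear_extensions_Restr)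
      have ran: "g y < n" "1 \<le> g y" if "y \<in> X" "y \<noteq> m" for y
        using PiE_mem[OF gP, of y] that n by auto
      have X: "insert m (X - {m}) = X" using mX by blast
      have nn: "insert n {1..n - 1} = {1..n}" using n by auto
      have "bij_betw (g(m := n)) (X - {m}) {1..n - 1}"
        using gb by (rule iffD1[OF bij_betw_cong, rotated]) auto
      then have "bij_betw (g(m := n)) (X - {m} \<union> {m}) ({1..n - 1} \<union> {(g(m := n)) m})"
        using n by (intro notIn_Un_bij_betw) auto
      then have "bij_betw (g(m := n)) X {1..n}" using X nn by (simp add: insert_absorb)
      moreover have "g(m := n) \<in> X \<rightarrow>\<^sub>E {1..n}"
        using ran gP n mX by (auto simp: PiE_def extensional_def Pi_def less_imp_le)
      moreover have "\<forall>a\<in>X. \<forall>b\<in>X. (a, b) \<in> r \<longrightarrow> (g(m := n)) a < (g(m := n)) b"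
        using gr ran m by (auto simp: M_def)
      ultimately show "?ext p \<in> L X" by (simp add: p L_def linear_extensions_Restr n_def)
    qed
    show "?res ` L X \<subseteq> (SIGMA m:M. L (X - {m}))"
    proof (rule image_subsetI)
      fix f assume f: "f \<in> L X"
      have fP: "f \<in> X \<rightarrow>\<^sub>E {1..n}" and fb: "bij_betw f X {1..n}"
        and fr: "\<forall>a\<in>X. \<forall>b\<in>X. (a, b) \<in> r \<longrightarrow> f a < f b"
        using f by (simp_all add: L_def linear_extensions_Restr n_def)
      define m where "m = inv_into X f n"
      have "n \<in> f ` X" using fb n by (simp add: bij_betw_def)
      then have m: "m \<in> X" "f m = n" by (simp_all add: inv_into_into f_inv_into_f m_def)
      have ran: "1 \<le> f y" "f y \<le> n" if "y \<in> X" for y using PiE_mem[OF fP that] by auto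
      \<comment> \<open>If \<open>m\<close> were below some \<open>y\<close> in \<open>X\<close>,
        then \<open>n = f m < f y \<le> n\<close>.\<close>
      have "m \<in> M" using m fr ran by (auto simp: M_def) (metis not_le)
      moreover have "restrict f (X - {m}) \<in> L (X - {m})"
      proof -
        have eq: "{1..n} - {f m} = {1..n - 1}" using m(2) n by auto
        have b: "bij_betw f (X - {m}) {1..n - 1}"
          using bij_betw_DiffI[OF fb, of "{m}" "{f m}"] m eq n by simp
        then have "bij_betw (restrict f (X - {m})) (X - {m}) {1..n - 1}"
          by (rule iffD1[OF bij_betw_cong, rotated]) auto
        moreover have "restrict f (X - {m}) \<in> (X - {m}) \<rightarrow>\<^sub>E {1..n - 1}"
          using bij_betwE[OF b] by auto
        ultimately show ?thesis
          using fr by (simp add: L_def linear_extensions_Restr cm[OF m(1)])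
      qed
      ultimately show "?res f \<in> (SIGMA m:M. L (X - {m}))" by (simp add: m_def)
    qed
  qed
  then have "card (L X) = card (SIGMA m:M. L (X - {m}))" by (simp add: bij_betw_same_card)
  also have "\<dots> = (\<Sum>m\<in>M. card (L (X - {m})))"
    using fin by (intro card_SigmaI) (auto simp: M_def L_def intro: finite_linear_extensions)
  finally show ?thesis by (simp add: count_ext_def num_ext_def L_def M_def)
qed

text \<open>Reversing the labels, \<open>k\<close> to \<open>n + 1 - k\<close>, is an involution
  that exchanges the linear extensions of \<open>r\<close> and of its converse.\<close>

lemma count_ext_converse:
  assumes fin: "finite X"
  shows "count_ext (r\<inverse>) X = count_ext r X"
proof -
  define n where "n = card X"
  define L where "L = (\<lambda>r. linear_extensions (X, Restr r X))"
  define rev where "rev = (\<lambda>f :: 'a \<Rightarrow> nat. \<lambda>x\<in>X. n + 1 - f x)"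
  have inv: "rev (rev f) = f" if "f \<in> L r" for f r
  proof -
    have fP: "f \<in> X \<rightarrow>\<^sub>E {1..n}" using that by (simp add: L_def linear_extensions_Restr n_def)
    show ?thesis
    proof
      fix x show "rev (rev f) x = f x"
        using PiE_mem[OF fP, of x] PiE_arb[OF fP, of x] by (auto simp: rev_def)
    qed
  qed
  have sub: "rev ` L r \<subseteq> L (r\<inverse>)" for r
  proof (rule image_subsetI)
    fix f assume f: "f \<in> L r"
    have fP: "f \<in> X \<rightarrow>\<^sub>E {1..n}" and fb: "bij_betw f X {1..n}"
      and fr: "\<And>a b. a \<in> X \<Longrightarrow> b \<in> X \<Longrightarrow> (a, b) \<in> r \<Longrightarrow> f a < f b"
      using f by (simp_all add: L_def linear_extensions_Restr n_def)
    have ran: "1 \<le> f y" "f y \<le> n" if "y \<in> X" for y using PiE_mem[OF fP that] by auto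
    have "bij_betw (\<lambda>k. n + 1 - k) {1..n} {1..n}"
      by (rule bij_betw_byWitness[where f' = "\<lambda>k. n + 1 - k"]) auto
    from bij_betw_trans[OF fb this] have "bij_betw (\<lambda>x. n + 1 - f x) X {1..n}" by (simp add: o_def)
    then have "bij_betw (rev f) X {1..n}"
      by (rule iffD1[OF bij_betw_cong, rotated]) (auto simp: rev_def)
    moreover have "rev f \<in> X \<rightarrow>\<^sub>E {1..n}" using ran by (fastforce simp: rev_def)
    moreover have "rev f a < rev f b" if "a \<in> X" "b \<in> X" "(b, a) \<in> r" for a b
      using fr[of b a] ran[of a] ran[of b] that by (simp add: rev_def)
    ultimately show "rev f \<in> L (r\<inverse>)" by (simp add: L_def linear_extensions_Restr n_def)
  qed
  have "bij_betw rev (L (r\<inverse>)) (L r)"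
    using sub[of r] sub[of "r\<inverse>"] inv by (intro bij_betw_byWitness[where f' = rev]) auto
  then show ?thesis by (simp add: count_ext_def num_ext_def L_def bij_betw_same_card)
qed

text \<open>\<open>h\<close> carries maximal elements to maximal elements, so both counts obey the
  same recursion.\<close>

lemma count_ext_iso:
  assumes "finite X" "inj_on h X"
    and "\<And>a b. a \<in> X \<Longrightarrow> b \<in> X \<Longrightarrow> (h a, h b) \<in> s \<longleftrightarrow> (a, b) \<in> r"
  shows "count_ext s (h ` X) = count_ext r X"
  using assms
proof (induction "card X" arbitrary: X)
  case 0
  then show ?case by simp
next
  case (Suc k)
  then have ne: "X \<noteq> {}" by auto
  have eq: "{m \<in> h ` X. \<forall>y\<in>h ` X. (m, y) \<notin> s} = h ` {m \<in> X. \<forall>y\<in>X. (m, y) \<notin> r}"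
    using Suc.prems(3) by auto
  have "count_ext s (h ` X) =
      (\<Sum>m\<in>h ` {m \<in> X. \<forall>y\<in>X. (m, y) \<notin> r}. count_ext s (h ` X - {m}))"
    using count_ext_rec[of "h ` X" s] Suc.prems(1) ne unfolding eq by simp
  also have "\<dots> = (\<Sum>m | m \<in> X \<and> (\<forall>y\<in>X. (m, y) \<notin> r). count_ext s (h ` X - {h m}))"
    using Suc.prems(2) by (subst sum.reindex) (auto intro: inj_on_subset simp: o_def)
  also have "\<dots> = (\<Sum>m | m \<in> X \<and> (\<forall>y\<in>X. (m, y) \<notin> r). count_ext r (X - {m}))"
  proof (rule sum.cong)
    fix m assume "m \<in> {m \<in> X. \<forall>y\<in>X. (m, y) \<notin> r}"
    then have m: "m \<in> X" by simp
    have "h ` X - {h m} = h ` (X - {m})" using m Suc.prems(2) by (auto simp: inj_on_def)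
    moreover have "count_ext s (h ` (X - {m})) = count_ext r (X - {m})"
      using Suc.prems Suc.hyps m by (intro Suc.hyps(1)) (auto intro: inj_on_subset)
    ultimately show "count_ext s (h ` X - {h m}) = count_ext r (X - {m})" by simp
  qed simp
  also have "\<dots> = count_ext r X" using count_ext_rec[of X r] Suc.prems(1) ne by simp
  finally show ?case .
qed

lemma count_ext_cong:
  assumes "finite X" "\<And>a b. a \<in> X \<Longrightarrow> b \<in> X \<Longrightarrow> (a, b) \<in> s \<longleftrightarrow> (a, b) \<in> r"
  shows "count_ext s X = count_ext r X"
  using count_ext_iso[of X id s r] assms by simp

text \<open>A finite nonempty strict order has a maximal element, so some summand of the recursion
  is positive. This makes the denominators in \<open>rho\<close> nonzero.\<close>

lemma count_ext_pos:
  assumes "finite X" "irrefl r" "trans r"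
  shows "count_ext r X > 0"
  using assms(1)
proof (induction "card X" arbitrary: X)
  case 0
  then show ?case by simp
next
  case (Suc k)
  then have ne: "X \<noteq> {}" by auto
  have "irrefl (Restr r X)" "trans (Restr r X)"
    using assms by (auto simp: irrefl_def trans_Restr)
  then have "acyclic (Restr r X)" by (simp add: acyclic_irrefl)
  then have "wf ((Restr r X)\<inverse>)" using Suc.prems
    by (intro finite_acyclic_wf_converse) (auto intro: finite_subset[of _ "X \<times> X"])
  then obtain m where m: "m \<in> X" "\<And>y. (m, y) \<in> Restr r X \<Longrightarrow> y \<notin> X"
    using ne wfE_min'[of "(Restr r X)\<inverse>" X] by (metis converse_iff)
  have "k = card (X - {m})" using Suc.hyps(2) Suc.prems m(1) by simp
  then have "count_ext r (X - {m}) > 0" using Suc.hyps(1) Suc.prems by simp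
  moreover have "m \<in> {m \<in> X. \<forall>y\<in>X. (m, y) \<notin> r}" using m by blast
  ultimately have "(\<Sum>m | m \<in> X \<and> (\<forall>y\<in>X. (m, y) \<notin> r). count_ext r (X - {m})) > 0"
    using Suc.prems by (intro sum_pos2[of _ m]) auto
  then show ?case using count_ext_rec[of X r] ne Suc.prems by simp
qed

section \<open>Isolated elements, linear sums and linear sums lacking one relation\<close>

text \<open>The new element fits into each of the \<open>card Y + 1\<close> gaps. In the recursion,
  \<open>x\<close> as top contributes \<open>count_ext r Y\<close> once, and the other tops together
  contribute it \<open>card Y\<close> times.\<close>

lemma count_ext_insert_isolated:
  assumes "finite Y" "x \<notin> Y" "(x, x) \<notin> r" "\<And>y. y \<in> Y \<Longrightarrow> (x, y) \<notin> r \<and> (y, x) \<notin> r"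
  shows "count_ext r (insert x Y) = (card Y + 1) * count_ext r Y"
  using assms
proof (induction "card Y" arbitrary: Y)
  case 0
  then show ?case using count_ext_rec[of "{x}" r] by (simp add: conj_commute cong: conj_cong)
next
  case (Suc k)
  define M where "M = {m \<in> Y. \<forall>y\<in>Y. (m, y) \<notin> r}"
  have ne: "Y \<noteq> {}" and fM: "finite M" using Suc by (auto simp: M_def)
  have xM: "x \<notin> M" using Suc by (auto simp: M_def)
  have M': "{m \<in> insert x Y. \<forall>y\<in>insert x Y. (m, y) \<notin> r} = insert x M"
    using Suc.prems by (auto simp: M_def)
  have "count_ext r (insert x Y) = (\<Sum>m\<in>insert x M. count_ext r (insert x Y - {m}))"
    using count_ext_rec[of "insert x Y" r] Suc.prems(1) unfolding M' by simp
  also have "\<dots> = count_ext r Y + (\<Sum>m\<in>M. count_ext r (insert x Y - {m}))"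
    using fM xM Suc.prems(2) by simp
  also have "(\<Sum>m\<in>M. count_ext r (insert x Y - {m})) = (\<Sum>m\<in>M. card Y * count_ext r (Y - {m}))"
  proof (rule sum.cong)
    fix m assume "m \<in> M"
    then have m: "m \<in> Y" by (simp add: M_def)
    have "insert x Y - {m} = insert x (Y - {m})" using m Suc.prems by auto
    moreover have "count_ext r (insert x (Y - {m})) = (card (Y - {m}) + 1) * count_ext r (Y - {m})"
      using Suc m by (intro Suc.hyps(1)) auto
    moreover have "card (Y - {m}) + 1 = card Y" using m Suc by simp
    ultimately show "count_ext r (insert x Y - {m}) = card Y * count_ext r (Y - {m})" by metis
  qed simp
  also have "\<dots> = card Y * count_ext r Y"
    using count_ext_rec[of Y r] Suc.prems(1) ne by (simp add: M_def sum_distrib_left)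
  finally show ?case by simp
qed

text \<open>While \<open>Z\<close> is nonempty, the maximal elements of the union are those of
  \<open>Z\<close>, so \<open>Z\<close> is removed first. An element of \<open>Y\<close> with
  something above it in \<open>Y\<close> may reach \<open>Z\<close> indirectly; this form suits
  relations that are not transitively closed.\<close>

lemma count_ext_linear_sum:
  assumes "finite Y" "finite Z" "Y \<inter> Z = {}"
    and "\<And>y z. y \<in> Y \<Longrightarrow> z \<in> Z \<Longrightarrow> (z, y) \<notin> r"
    and "\<And>y. y \<in> Y \<Longrightarrow> {y} \<times> Z \<subseteq> r \<or> (\<exists>y'\<in>Y. (y, y') \<in> r)"
  shows "count_ext r (Y \<union> Z) = count_ext r Y * count_ext r Z"
  using assms
proof (induction "card Z" arbitrary: Z)
  case 0
  then show ?case by simp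
next
  case (Suc k)
  then have ne: "Z \<noteq> {}" by auto
  have M: "{m \<in> Y \<union> Z. \<forall>y\<in>Y \<union> Z. (m, y) \<notin> r} = {m \<in> Z. \<forall>y\<in>Z. (m, y) \<notin> r}"
    using Suc.prems(4,5) ne by blast
  have "count_ext r (Y \<union> Z) = (\<Sum>m | m \<in> Z \<and> (\<forall>y\<in>Z. (m, y) \<notin> r). count_ext r (Y \<union> Z - {m}))"
    using count_ext_rec[of "Y \<union> Z" r] Suc.prems(1,2) ne unfolding M by simp
  also have "\<dots> = (\<Sum>m | m \<in> Z \<and> (\<forall>y\<in>Z. (m, y) \<notin> r). count_ext r Y * count_ext r (Z - {m}))"
  proof (rule sum.cong)
    fix m assume "m \<in> {m \<in> Z. \<forall>y\<in>Z. (m, y) \<notin> r}"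
    then have m: "m \<in> Z" by simp
    have "Y \<union> Z - {m} = Y \<union> (Z - {m})" using m Suc.prems(3) by auto
    moreover have "count_ext r (Y \<union> (Z - {m})) = count_ext r Y * count_ext r (Z - {m})"
    proof (rule Suc.hyps(1))
      show "\<And>y. y \<in> Y \<Longrightarrow> {y} \<times> (Z - {m}) \<subseteq> r \<or> (\<exists>y'\<in>Y. (y, y') \<in> r)"
        using Suc.prems(5) by blast
    qed (use Suc m in auto)
    ultimately show "count_ext r (Y \<union> Z - {m}) = count_ext r Y * count_ext r (Z - {m})" by simp
  qed simp
  also have "\<dots> = count_ext r Y * count_ext r Z"
    using count_ext_rec[of Z r] Suc.prems(2) ne by (simp add: sum_distrib_left)
  finally show ?case .
qed

lemma count_ext_singleton: "(x, x) \<notin> r \<Longrightarrow> count_ext r {x} = 1"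
  using count_ext_insert_isolated[of "{}" x r] by simp

text \<open>A linear extension puts either \<open>a\<close> before \<open>b\<close> or
  \<open>b\<close> before \<open>a\<close>. On the set of maximal elements, an added pair just
  removes its lower end.\<close>

lemma count_ext_split:
  assumes "finite X" "a \<in> X" "b \<in> X" "a \<noteq> b"
  shows "count_ext r X = count_ext (insert (a, b) r) X + count_ext (insert (b, a) r) X"
  using assms
proof (induction "card X" arbitrary: X)
  case 0
  then show ?case by simp
next
  case (Suc k)
  define M where "M = (\<lambda>r. {m \<in> X. \<forall>y\<in>X. (m, y) \<notin> r})"
  have fM: "finite (M r)" for r using Suc by (auto simp: M_def)
  have Mab: "M (insert (a, b) r) = M r - {a}" and Mba: "M (insert (b, a) r) = M r - {b}"
    using Suc.prems by (auto simp: M_def)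
  have rec: "count_ext r X = (\<Sum>m\<in>M r. count_ext r (X - {m}))" for r
    using count_ext_rec[of X r] Suc.prems by (auto simp: M_def)
  \<comment> \<open>Once an end of the added pair is deleted, the pair has no effect. So for
    \<open>m = a\<close> only the \<open>(b, a)\<close> summand survives, and it equals the original
    one; \<open>m = b\<close> is symmetric.\<close>
  have irr: "count_ext (insert (c, d) r) (X - {m}) = count_ext r (X - {m})"
    if "m = c \<or> m = d" for c d m
    using Suc.prems that by (intro count_ext_cong) auto
  have drop: "(\<Sum>m\<in>M r - {c}. f m) = (\<Sum>m\<in>M r. if m = c then 0 else f m)" for c and f :: "'a \<Rightarrow> nat"
    using fM by (intro sum.mono_neutral_cong_left) auto
  have "count_ext (insert (a, b) r) X + count_ext (insert (b, a) r) X =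
      (\<Sum>m\<in>M r. (if m = a then 0 else count_ext (insert (a, b) r) (X - {m})) +
        (if m = b then 0 else count_ext (insert (b, a) r) (X - {m})))"
    unfolding rec[of "insert _ r"] Mab Mba drop by (simp add: sum.distrib)
  also have "\<dots> = (\<Sum>m\<in>M r. count_ext r (X - {m}))"
  proof (rule sum.cong)
    fix m assume "m \<in> M r"
    then have m: "m \<in> X" by (simp add: M_def)
    show "(if m = a then 0 else count_ext (insert (a, b) r) (X - {m})) +
        (if m = b then 0 else count_ext (insert (b, a) r) (X - {m})) = count_ext r (X - {m})"
    proof (cases "m = a \<or> m = b")
      case True
      then show ?thesis using irr Suc.prems(4) by auto
    next
      case False
      then have "count_ext r (X - {m}) =
          count_ext (insert (a, b) r) (X - {m}) + count_ext (insert (b, a) r) (X - {m})"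
        using Suc m by (intro Suc.hyps(1)) auto
      then show ?thesis using False by simp
    qed
  qed simp
  also have "\<dots> = count_ext r X" by (rule rec[symmetric])
  finally show ?case by simp
qed

text \<open>Either \<open>c\<close> precedes \<open>a\<close>, or \<open>a\<close> and \<open>c\<close> are adjacent and separate \<open>C - {c}\<close> from \<open>A - {a}\<close>.\<close>

lemma count_ext_almost_linear_sum:
  assumes fin: "finite A" "finite C" and disj: "A \<inter> C = {}" and a: "a \<in> A" and c: "c \<in> C"
    and CA: "C \<times> A - {(c, a)} \<subseteq> r" and AC: "\<And>u v. u \<in> A \<Longrightarrow> v \<in> C \<Longrightarrow> (u, v) \<notin> r"
    and amin: "\<And>u. u \<in> A \<Longrightarrow> (u, a) \<notin> r" and cmax: "\<And>v. v \<in> C \<Longrightarrow> (c, v) \<notin> r"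
    and ca: "(c, a) \<notin> r"
  shows "count_ext r (A \<union> C) =
    count_ext r A * count_ext r C + count_ext r (A - {a}) * count_ext r (C - {c})"
proof -
  have ne: "c \<noteq> a" using disj a c by auto
  \<comment> \<open>In \<open>s\<close> the element \<open>c\<close> is forced below
    \<open>a\<close>, which completes a linear sum. In \<open>t\<close> it is forced above
    \<open>a\<close>, which gives the sequence \<open>C - {c}\<close>, \<open>a\<close>,
    \<open>c\<close>, \<open>A - {a}\<close>.\<close>
  define s where "s = insert (c, a) r"
  define t where "t = insert (a, c) r"
  have s: "count_ext s (C \<union> A) = count_ext r C * count_ext r A"
  proof -
    have "count_ext s (C \<union> A) = count_ext s C * count_ext s A"
      by (rule count_ext_linear_sum) (use fin disj AC CA ne a c in \<open>auto simp: s_def\<close>)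
    moreover have "count_ext s C = count_ext r C" "count_ext s A = count_ext r A"
      using disj a c fin by (auto simp: s_def intro!: count_ext_cong)
    ultimately show ?thesis by simp
  qed
  have t: "count_ext t (C \<union> A) = count_ext r (C - {c}) * count_ext r (A - {a})"
  proof -
    have "count_ext t (insert a C \<union> (A - {a})) = count_ext t (insert a C) * count_ext t (A - {a})"
    proof (rule count_ext_linear_sum)
      show "\<And>y z. y \<in> insert a C \<Longrightarrow> z \<in> A - {a} \<Longrightarrow> (z, y) \<notin> t"
        using AC amin by (auto simp: t_def)
      fix y assume y: "y \<in> insert a C"
      \<comment> \<open>\<open>a\<close> need not lie below \<open>A - {a}\<close>, but
        \<open>t\<close> puts it below \<open>c\<close>.\<close>
      show "{y} \<times> (A - {a}) \<subseteq> t \<or> (\<exists>y'\<in>insert a C. (y, y') \<in> t)"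
        using y CA c by (cases "y = a") (auto simp: t_def)
    qed (use fin disj in auto)
    moreover have "count_ext t (insert a (C - {c}) \<union> {c}) =
        count_ext t (insert a (C - {c})) * count_ext t {c}"
      by (rule count_ext_linear_sum) (use fin disj cmax ca CA a c ne in \<open>auto simp: t_def\<close>)
    moreover have "count_ext t ((C - {c}) \<union> {a}) = count_ext t (C - {c}) * count_ext t {a}"
      by (rule count_ext_linear_sum) (use fin disj AC CA a in \<open>auto simp: t_def\<close>)
    moreover have "count_ext t {c} = 1" "count_ext t {a} = 1"
      using amin[OF a] cmax[OF c] ne count_ext_singleton[of c t] count_ext_singleton[of a t]
      by (auto simp: t_def)
    moreover have "count_ext t (C - {c}) = count_ext r (C - {c})"
        "count_ext t (A - {a}) = count_ext r (A - {a})"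
      using fin by (auto simp: t_def intro!: count_ext_cong)
    moreover have "insert a C \<union> (A - {a}) = C \<union> A" "insert a (C - {c}) \<union> {c} = insert a C"
        "(C - {c}) \<union> {a} = insert a (C - {c})" using a c by auto
    ultimately show ?thesis by simp
  qed
  have "count_ext r (C \<union> A) = count_ext s (C \<union> A) + count_ext t (C \<union> A)"
    unfolding s_def t_def using fin a c ne by (intro count_ext_split) auto
  then show ?thesis unfolding s t by (simp add: Un_commute mult.commute)
qed

text \<open>The order runs against that of the numbers, so the largest number is a bottom summand of
  size one.\<close>

lemma count_ext_chain:
  "finite (F :: nat set) \<Longrightarrow> (\<And>i j. i \<in> F \<Longrightarrow> j \<in> F \<Longrightarrow> (i, j) \<in> r \<longleftrightarrow> j < i) \<Longrightarrow> count_ext r F = 1"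
proof (induction rule: finite_linorder_max_induct)
  case empty
  then show ?case by simp
next
  case (insert b F)
  have "count_ext r ({b} \<union> F) = count_ext r {b} * count_ext r F"
    by (rule count_ext_linear_sum) (use insert in \<open>auto simp: not_less\<close>)
  then show ?case using insert by (simp add: count_ext_singleton)
qed

section \<open>The poset of the reduction\<close>

text \<open>The numbers below \<open>n1\<close> carry the first poset. The interval from \<open>n1\<close> to \<open>n1 + n2\<close> carries
  the dual of the second one, with a chain of \<open>N - n2\<close> elements below it. These \<open>N\<close> elements precede
  the first poset except that \<open>n1 + x2\<close> and \<open>x1\<close> are incomparable. The element \<open>n1 + N\<close> precedes the
  first poset and is incomparable to the rest.\<close>

definition glued_order ::
    "nat \<Rightarrow> (nat \<times> nat) set \<Rightarrow> nat \<Rightarrow> nat \<Rightarrow> (nat \<times> nat) set \<Rightarrow> nat \<Rightarrow> nat \<Rightarrow> (nat \<times> nat) set" where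
  "glued_order n1 r1 x1 n2 r2 x2 N = {(i, j).
     if i < n1 then j < n1 \<and> (i, j) \<in> r1
     else if i < n1 + n2 then
       (if j < n1 then \<not> (i = n1 + x2 \<and> j = x1) else j < n1 + n2 \<and> (j - n1, i - n1) \<in> r2)
     else if i < n1 + N then j < i
     else i = n1 + N \<and> j < n1}"

fun glue :: "pointed \<Rightarrow> pointed \<Rightarrow> nat \<Rightarrow> pointed" where
  "glue ((X1, r1), x1) ((X2, r2), x2) N =
    (({..<card X1 + N + 1}, glued_order (card X1) r1 x1 (card X2) r2 x2 N), card X1 + N)"

lemma pointed_posetsD:
  assumes "((X, r), x) \<in> pointed_posets"
  shows "X = {..<card X}" "r \<subseteq> X \<times> X" "irrefl r" "trans r" "x < card X" "\<And>a. (a, x) \<notin> r"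
proof -
  show X: "X = {..<card X}" and r: "r \<subseteq> X \<times> X" "irrefl r" "trans r"
    using assms by (auto simp: pointed_posets_def finite_poset_def)
  have "x \<in> X" "\<forall>a\<in>X. (a, x) \<notin> r" using assms by (auto simp: pointed_posets_def min_elems_def)
  then show "x < card X" "\<And>a. (a, x) \<notin> r" using X r(1) by auto
qed

text \<open>Transitivity could fail only at the omitted pair \<open>(n1 + x2, x1)\<close>. An
  element between these two would lie below \<open>x1\<close> in the first poset or come from one
  below \<open>x2\<close> in the second; minimality excludes both.\<close>

lemma glue_pointed_posets:
  assumes "((X1, r1), x1) \<in> pointed_posets" "((X2, r2), x2) \<in> pointed_posets" "card X2 \<le> N"
  shows "glue ((X1, r1), x1) ((X2, r2), x2) N \<in> pointed_posets"
proof -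
  note p1 = pointed_posetsD[OF assms(1)] and p2 = pointed_posetsD[OF assms(2)]
  define n1 n2 where "n1 = card X1" and "n2 = card X2"
  let ?r = "glued_order n1 r1 x1 n2 r2 x2 N"
  have ir: "(a, a) \<notin> r1" "(a, a) \<notin> r2" for a using p1(3) p2(3) by (auto simp: irrefl_def)
  have n: "n2 \<le> N" using assms(3) by (simp add: n2_def)
  have "?r \<subseteq> {..<n1 + N + 1} \<times> {..<n1 + N + 1}"
    using n by (auto simp: glued_order_def split: if_splits)
  moreover have "irrefl ?r" using ir by (auto simp: irrefl_def glued_order_def)
  moreover have "trans ?r"
  proof (rule transI)
    fix i j k assume ij: "(i, j) \<in> ?r" and jk: "(j, k) \<in> ?r"
    consider "i < n1" | "n1 \<le> i" "i < n1 + n2" | "n1 + n2 \<le> i" by linarith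
    then show "(i, k) \<in> ?r"
    proof cases
      case 1
      then show ?thesis using ij jk transD[OF p1(4), of i j k] by (auto simp: glued_order_def)
    next
      case 2
      show ?thesis
      proof (cases "j < n1")
        case True
        then show ?thesis using 2 jk p1(6) by (auto simp: glued_order_def)
      next
        case False
        then have j: "j < n1 + n2" "(j - n1, i - n1) \<in> r2" using 2 ij by (auto simp: glued_order_def)
        have "i \<noteq> n1 + x2" using j(2) p2(6) by auto
        then show ?thesis
          using 2 j False jk transD[OF p2(4), of "k - n1" "j - n1" "i - n1"]
          by (auto simp: glued_order_def split: if_splits)
      qed
    next
      case 3
      then show ?thesis using ij jk by (auto simp: glued_order_def split: if_splits)
    qed
  qed
  moreover have "n1 + N \<in> min_elems ({..<n1 + N + 1}, ?r)"
    using n by (auto simp: min_elems_def glued_order_def)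
  ultimately show ?thesis by (simp add: pointed_posets_def finite_poset_def n1_def n2_def)
qed

section \<open>The ratio \<open>rho\<close> of the glued poset\<close>

lemma num_ext_poset: "r \<subseteq> X \<times> X \<Longrightarrow> num_ext (X, r) = count_ext r X"
  unfolding count_ext_def by (simp add: Int_absorb2)

lemma num_ext_delete: "num_ext (delete (X, r) x) = count_ext r (X - {x})"
  by (simp add: count_ext_def delete_def)

text \<open>The padding chain is a lower summand with one linear extension, and dualizing keeps the
  count. \<open>D\<close> is general because the second poset is needed both with and without
  \<open>x2\<close>.\<close>

lemma count_ext_glued_order_padded_dual:
  assumes "D \<subseteq> {..<n2}" "n2 \<le> N"
  shows "count_ext (glued_order n1 r1 x1 n2 r2 x2 N) ({n1 + n2..<n1 + N} \<union> (+) n1 ` D) = count_ext r2 D"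
proof -
  let ?r = "glued_order n1 r1 x1 n2 r2 x2 N"
  have fD: "finite D" using assms(1) finite_subset by blast
  have "count_ext ?r ({n1 + n2..<n1 + N} \<union> (+) n1 ` D) =
      count_ext ?r {n1 + n2..<n1 + N} * count_ext ?r ((+) n1 ` D)"
    using assms fD by (intro count_ext_linear_sum) (auto simp: glued_order_def)
  also have "count_ext ?r {n1 + n2..<n1 + N} = 1"
    by (intro count_ext_chain) (auto simp: glued_order_def)
  also have "count_ext ?r ((+) n1 ` D) = count_ext (r2\<inverse>) D"
    using assms fD by (intro count_ext_iso) (auto simp: glued_order_def)
  also have "\<dots> = count_ext r2 D" using fD by (rule count_ext_converse)
  finally show ?thesis by simp
qed

text \<open>With \<open>u = a * b\<close> and \<open>v = a' * b'\<close>, the numerator is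
  \<open>N * (u + v) + u\<close>, the denominator is \<open>u + v\<close>, and
  \<open>t = u / v\<close>. Positivity of \<open>t\<close> is recorded for the later comparison of
  two such ratios.\<close>

lemma rho_glue:
  assumes P1: "((X1, r1), x1) \<in> pointed_posets" and P2: "((X2, r2), x2) \<in> pointed_posets"
    and N: "card X2 \<le> N"
    and t: "t = rho (X1, r1) x1 * rho (X2, r2) x2"
  shows "(case glue ((X1, r1), x1) ((X2, r2), x2) N of (P, x) \<Rightarrow> rho P x) = of_nat N + t / (1 + t)"
    and "t > 0"
proof -
  note p1 = pointed_posetsD[OF P1] and p2 = pointed_posetsD[OF P2]
  define n1 n2 where "n1 = card X1" and "n2 = card X2"
  have X: "X1 = {..<n1}" "X2 = {..<n2}" using p1(1) p2(1) by (simp_all add: n1_def n2_def)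
  have x: "x1 < n1" "x2 < n2" using p1(5) p2(5) by (simp_all add: n1_def n2_def)
  have n: "n2 \<le> N" using N by (simp add: n2_def)
  define r where "r = glued_order n1 r1 x1 n2 r2 x2 N"
  define A C c z where "A = {..<n1}" and "C = {n1..<n1 + N}" and "c = n1 + x2" and "z = n1 + N"
  define a b a' b' where "a = count_ext r1 X1" and "b = count_ext r2 X2"
    and "a' = count_ext r1 (X1 - {x1})" and "b' = count_ext r2 (X2 - {x2})"
  have pos: "a > 0" "b > 0" "a' > 0" "b' > 0"
    using p1(3,4) p2(3,4) X by (auto simp: a_def b_def a'_def b'_def intro!: count_ext_pos)
  have A: "count_ext r A = a" "count_ext r (A - {x1}) = a'"
    unfolding a_def a'_def X A_def by (auto simp: r_def glued_order_def intro!: count_ext_cong)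
  have img: "(+) n1 ` {..<n2} = {n1..<n1 + n2}" by (simp add: lessThan_atLeast0 add.commute)
  have Ceq: "C = {n1 + n2..<n1 + N} \<union> (+) n1 ` {..<n2}" unfolding img using n by (auto simp: C_def)
  have Ceq': "C - {c} = {n1 + n2..<n1 + N} \<union> (+) n1 ` ({..<n2} - {x2})"
    unfolding Ceq using x by (auto simp: c_def)
  have C: "count_ext r C = b" "count_ext r (C - {c}) = b'"
    unfolding Ceq' unfolding Ceq r_def b_def b'_def X
    by (rule count_ext_glued_order_padded_dual[OF _ n], blast)+
  have cC: "c \<in> C" "card C = N" "finite C" using x n by (auto simp: C_def c_def)
  have zC: "count_ext r (insert z D) = (card D + 1) * count_ext r D" if "D \<subseteq> C" for D
    using that finite_subset[OF that] n
    by (intro count_ext_insert_isolated) (auto simp: C_def z_def r_def glued_order_def)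
  have sum: "count_ext r (A \<union> C) = a * b + a' * b'"
    unfolding A(1)[symmetric] A(2)[symmetric] C(1)[symmetric] C(2)[symmetric]
    by (rule count_ext_almost_linear_sum)
      (use x n p1(6) p2(6) cC in \<open>auto simp: A_def C_def c_def r_def glued_order_def\<close>)
  \<comment> \<open>The same lemma with \<open>z\<close> joined to the lower part, since
    \<open>z\<close> lies below all of \<open>A\<close>.\<close>
  have "count_ext r (A \<union> insert z C) =
      count_ext r A * count_ext r (insert z C) + count_ext r (A - {x1}) * count_ext r (insert z C - {c})"
    by (rule count_ext_almost_linear_sum)
      (use x n p1(6) p2(6) in \<open>auto simp: A_def C_def c_def r_def z_def glued_order_def\<close>)
  also have "count_ext r (insert z C) = (N + 1) * b" using zC[of C] C cC by simp
  also have "insert z C - {c} = insert z (C - {c})" using x n by (auto simp: z_def c_def)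
  \<comment> \<open>\<open>C - {c}\<close> has \<open>N - 1\<close> elements, hence \<open>N\<close>
    places for \<open>z\<close>.\<close>
  also have "count_ext r (insert z (C - {c})) = N * b'"
    using zC[of "C - {c}"] C(2) cC x n by (simp add: card_Diff_singleton)
  finally have sumz: "count_ext r (A \<union> insert z C) = a * ((N + 1) * b) + a' * (N * b')"
    by (simp only: A)
  have "glue ((X1, r1), x1) ((X2, r2), x2) N = ((A \<union> insert z C, r), z)"
    by (auto simp: A_def C_def z_def r_def n1_def n2_def)
  moreover have "A \<union> insert z C - {z} = A \<union> C" by (auto simp: A_def C_def z_def)
  moreover have "r \<subseteq> (A \<union> insert z C) \<times> (A \<union> insert z C)"
    using glue_pointed_posets[OF P1 P2 N] pointed_posetsD(2) calculation(1) by metis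
  ultimately have 1: "(case glue ((X1, r1), x1) ((X2, r2), x2) N of (P, x) \<Rightarrow> rho P x) =
      of_nat (a * ((N + 1) * b) + a' * (N * b')) / of_nat (a * b + a' * b')"
    by (simp only: prod.case rho_def num_ext_poset num_ext_delete sum sumz)
  have tt: "t = of_nat a / of_nat a' * (of_nat b / of_nat b')"
    by (simp add: t rho_def num_ext_poset[OF p1(2)] num_ext_poset[OF p2(2)] num_ext_delete
        a_def b_def a'_def b'_def)
  show "t > 0" unfolding tt using pos by simp
  define u v :: rat where "u = of_nat (a * b)" and "v = of_nat (a' * b')"
  have uv: "u > 0" "v > 0" using pos by (simp_all add: u_def v_def)
  have tuv: "t = u / v" by (simp add: tt u_def v_def)
  have "of_nat (a * ((N + 1) * b) + a' * (N * b')) = of_nat N * (u + v) + u"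
    by (simp add: u_def v_def algebra_simps)
  moreover have "(of_nat (a * b + a' * b') :: rat) = u + v" by (simp add: u_def v_def)
  moreover have "(of_nat N * (u + v) + u) / (u + v) = of_nat N + t / (1 + t)"
    unfolding tuv using uv by (simp add: field_simps)
  ultimately show "(case glue ((X1, r1), x1) ((X2, r2), x2) N of (P, x) \<Rightarrow> rho P x) =
      of_nat N + t / (1 + t)"
    using 1 by simp
qed

text \<open>The common summand \<open>N\<close> cancels, and \<open>t / (1 + t)\<close> is injective
  on positive numbers.\<close>

lemma rho_glue_eq_iff:
  assumes "((X1, r1), x1) \<in> pointed_posets" "((X2, r2), x2) \<in> pointed_posets"
    "((X3, r3), x3) \<in> pointed_posets" "((X4, r4), x4) \<in> pointed_posets"
    "card X2 \<le> N" "card X3 \<le> N"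
    "glue ((X1, r1), x1) ((X2, r2), x2) N = (P, x)" "glue ((X4, r4), x4) ((X3, r3), x3) N = (Q, y)"
  shows "rho P x = rho Q y \<longleftrightarrow> rho (X1, r1) x1 * rho (X2, r2) x2 = rho (X3, r3) x3 * rho (X4, r4) x4"
proof -
  define t where "t = rho (X1, r1) x1 * rho (X2, r2) x2"
  define s where "s = rho (X4, r4) x4 * rho (X3, r3) x3"
  have "rho P x = of_nat N + t / (1 + t)" "t > 0"
    using rho_glue[OF assms(1,2,5) t_def] unfolding assms(7) by simp_all
  moreover have "rho Q y = of_nat N + s / (1 + s)" "s > 0"
    using rho_glue[OF assms(4,3,6) s_def] unfolding assms(8) by simp_all
  moreover have "t / (1 + t) = s / (1 + s) \<longleftrightarrow> t * (1 + s) = s * (1 + t)"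
    using \<open>t > 0\<close> \<open>s > 0\<close> by (intro frac_eq_eq) auto
  ultimately have "rho P x = rho Q y \<longleftrightarrow> t = s" by (simp add: algebra_simps)
  then show ?thesis by (simp add: t_def s_def mult.commute)
qed

section \<open>A small language compiled to programs\<close>

text \<open>Truth values are numbers, with 0 for false. \<open>Sym\<close> reads an input symbol and
  \<open>Ones\<close> a unary number; \<open>Times\<close> is needed for positions in a
  matrix.\<close>

datatype expr =
    Reg nat
  | Num nat
  | Plus expr expr
  | Minus expr expr
  | Times expr expr
  | Sym expr
  | Ones expr
  | Cond expr expr expr

definition ones :: "bool list \<Rightarrow> nat \<Rightarrow> nat" where
  "ones w p = length (takeWhile id (drop p w))"

primrec eval :: "bool list \<Rightarrow> (nat \<Rightarrow> nat) \<Rightarrow> expr \<Rightarrow> nat" where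
  "eval w R (Reg r) = R r"
| "eval w R (Num k) = k"
| "eval w R (Plus e f) = eval w R e + eval w R f"
| "eval w R (Minus e f) = eval w R e - eval w R f"
| "eval w R (Times e f) = eval w R e * eval w R f"
| "eval w R (Sym e) = input_symbol w (eval w R e)"
| "eval w R (Ones e) = ones w (eval w R e)"
| "eval w R (Cond e f g) = (if eval w R e \<noteq> 0 then eval w R f else eval w R g)"

primrec regs_below :: "nat \<Rightarrow> expr \<Rightarrow> bool" where
  "regs_below d (Reg r) \<longleftrightarrow> r < d"
| "regs_below d (Num k) \<longleftrightarrow> True"
| "regs_below d (Plus e f) \<longleftrightarrow> regs_below d e \<and> regs_below d f"
| "regs_below d (Minus e f) \<longleftrightarrow> regs_below d e \<and> regs_below d f"
| "regs_below d (Times e f) \<longleftrightarrow> regs_below d e \<and> regs_below d f"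
| "regs_below d (Sym e) \<longleftrightarrow> regs_below d e"
| "regs_below d (Ones e) \<longleftrightarrow> regs_below d e"
| "regs_below d (Cond e f g) \<longleftrightarrow> regs_below d e \<and> regs_below d f \<and> regs_below d g"

text \<open>For a symbol \<open>s\<close> in \<open>{0, 1, 2}\<close> this computes
  \<open>1 - ((1 - s) + (s - 1))\<close> with truncated subtraction, which is 1 exactly for
  \<open>s = 1\<close>. Register \<open>d + 3\<close> is expected to hold 1.\<close>

definition one_test :: "nat \<Rightarrow> prog" where
  "one_test d = Seq (Read (d + 2) (d + 1)) (Seq (Sub (d + 4) (d + 2) (d + 3))
     (Seq (Sub (d + 2) (d + 3) (d + 2)) (Seq (Add (d + 2) (d + 2) (d + 4))
       (Sub (d + 2) (d + 3) (d + 2)))))"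

text \<open>The value is left in register \<open>d\<close>; the registers above \<open>d\<close> serve as scratch space.\<close>

primrec compile :: "expr \<Rightarrow> nat \<Rightarrow> prog" where
  "compile (Reg r) d = Move d r"
| "compile (Num k) d = Const d k"
| "compile (Plus e f) d = Seq (compile e d) (Seq (compile f (d + 1)) (Add d d (d + 1)))"
| "compile (Minus e f) d = Seq (compile e d) (Seq (compile f (d + 1)) (Sub d d (d + 1)))"
| "compile (Times e f) d =
    Seq (compile e d) (Seq (compile f (d + 1)) (Seq (Const (d + 2) 0) (Seq (Const (d + 3) 1)
      (Seq (WhileNZ d (Seq (Add (d + 2) (d + 2) (d + 1)) (Sub d d (d + 3)))) (Move d (d + 2))))))"
| "compile (Sym e) d = Seq (compile e d) (Read d d)"
| "compile (Ones e) d =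
    Seq (compile e (d + 1)) (Seq (Const d 0) (Seq (Const (d + 3) 1)
      (Seq (one_test d) (WhileNZ (d + 2) (Seq (Add d d (d + 3)) (Seq (Add (d + 1) (d + 1) (d + 3))
        (one_test d)))))))"
| "compile (Cond e f g) d = Seq (compile e d) (IfNZ d (compile f d) (compile g d))"

text \<open>Here \<open>B\<close> bounds the contents of the registers and the length of the input.\<close>

primrec value_bound :: "expr \<Rightarrow> nat \<Rightarrow> nat" where
  "value_bound (Reg r) B = B"
| "value_bound (Num k) B = k"
| "value_bound (Plus e f) B = value_bound e B + value_bound f B"
| "value_bound (Minus e f) B = value_bound e B"
| "value_bound (Times e f) B = value_bound e B * value_bound f B"
| "value_bound (Sym e) B = 2"
| "value_bound (Ones e) B = B"
| "value_bound (Cond e f g) B = value_bound f B + value_bound g B"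

text \<open>The factors 3 and 8 are the costs of one round of the multiplication loop and of the
  counting loop, with the loop test. For \<open>Cond\<close> both branches are added, which avoids a
  maximum.\<close>

primrec time_bound :: "expr \<Rightarrow> nat \<Rightarrow> nat" where
  "time_bound (Reg r) B = 1"
| "time_bound (Num k) B = 1"
| "time_bound (Plus e f) B = time_bound e B + time_bound f B + 1"
| "time_bound (Minus e f) B = time_bound e B + time_bound f B + 1"
| "time_bound (Times e f) B = time_bound e B + time_bound f B + 3 * value_bound e B + 4"
| "time_bound (Sym e) B = time_bound e B + 1"
| "time_bound (Ones e) B = time_bound e B + 8 * B + 8"
| "time_bound (Cond e f g) B = time_bound e B + time_bound f B + time_bound g B + 1"

lemma input_symbol_le_2: "input_symbol w i \<le> 2"
  by (simp add: input_symbol_def)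

lemma ones_le_length: "ones w p \<le> length w"
  using length_takeWhile_le[of id "drop p w"] unfolding ones_def by simp

text \<open>The symbol 2 beyond the end of the input stops the count just as a zero does.\<close>

lemma ones_rec: "ones w p = (if input_symbol w p = 1 then Suc (ones w (Suc p)) else 0)"
proof (cases "p < length w")
  case True
  then show ?thesis
    by (simp add: ones_def input_symbol_def Cons_nth_drop_Suc[symmetric])
next
  case False
  then show ?thesis by (simp add: ones_def input_symbol_def)
qed

lemma eval_le_value_bound:
  "regs_below d e \<Longrightarrow> \<forall>r<d. R r \<le> B \<Longrightarrow> length w \<le> B \<Longrightarrow> eval w R e \<le> value_bound e B"
  by (induction e) (auto simp: input_symbol_le_2 trans_le_add1 trans_le_add2
      intro: add_mono mult_mono le_trans[OF ones_le_length] le_trans[OF diff_le_self])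

lemma eval_cong: "regs_below d e \<Longrightarrow> \<forall>r<d. R r = R' r \<Longrightarrow> eval w R e = eval w R' e"
  by (induction e) auto

text \<open>Induction on the counter in register \<open>d\<close>; each round keeps
  \<open>R (d + 2) + R d * R (d + 1)\<close> invariant.\<close>

lemma exec_multiply_loop:
  assumes "R (d + 3) = 1"
  shows "\<exists>R'. exec w (WhileNZ d (Seq (Add (d + 2) (d + 2) (d + 1)) (Sub d d (d + 3)))) (R, u)
      (3 * R d + 1) (R', u) \<and> R' (d + 2) = R (d + 2) + R d * R (d + 1) \<and> (\<forall>r<d. R' r = R r)"
  using assms
proof (induction "R d" arbitrary: R)
  case 0
  then show ?case using exec.WhileNZ_False[of R d w _ u] by force
next
  case (Suc k)
  let ?R1 = "R(d + 2 := R (d + 2) + R (d + 1))"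
  let ?R2 = "?R1(d := ?R1 d - ?R1 (d + 3))"
  have b: "exec w (Seq (Add (d + 2) (d + 2) (d + 1)) (Sub d d (d + 3))) (R, u) (1 + 1) (?R2, u)"
    by (rule exec.intros)+
  have k: "?R2 d = k" using Suc by simp
  obtain R' where R': "exec w (WhileNZ d (Seq (Add (d + 2) (d + 2) (d + 1)) (Sub d d (d + 3)))) (?R2, u)
      (3 * ?R2 d + 1) (R', u)" "R' (d + 2) = ?R2 (d + 2) + ?R2 d * ?R2 (d + 1)" "\<forall>r<d. R' r = ?R2 r"
    using Suc.hyps(1)[of ?R2] Suc.prems k by auto
  have "exec w (WhileNZ d (Seq (Add (d + 2) (d + 2) (d + 1)) (Sub d d (d + 3)))) (R, u)
      (1 + 1 + (3 * ?R2 d + 1) + 1) (R', u)"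
    using Suc.hyps(2) by (intro exec.WhileNZ_True[OF _ b R'(1)]) simp
  moreover have "1 + 1 + (3 * ?R2 d + 1) + 1 = 3 * R d + 1" unfolding k using Suc.hyps(2) by simp
  moreover have "R' (d + 2) = R (d + 2) + R d * R (d + 1)"
    unfolding R'(2) using k Suc.hyps(2)[symmetric] by simp
  ultimately show ?case using R'(3) by (intro exI[of _ R']) auto
qed

lemma exec_one_test:
  assumes "R (d + 3) = 1"
  shows "\<exists>R'. exec w (one_test d) (R, u) 5 (R', u) \<and>
    R' (d + 2) = of_bool (input_symbol w (R (d + 1)) = 1) \<and>
    (\<forall>r. r \<noteq> d + 2 \<longrightarrow> r \<noteq> d + 4 \<longrightarrow> R' r = R r)"
proof -
  let ?R1 = "R(d + 2 := input_symbol w (R (d + 1)))"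
  let ?R2 = "?R1(d + 4 := ?R1 (d + 2) - ?R1 (d + 3))"
  let ?R3 = "?R2(d + 2 := ?R2 (d + 3) - ?R2 (d + 2))"
  let ?R4 = "?R3(d + 2 := ?R3 (d + 2) + ?R3 (d + 4))"
  let ?R5 = "?R4(d + 2 := ?R4 (d + 3) - ?R4 (d + 2))"
  have "exec w (one_test d) (R, u) (1 + (1 + (1 + (1 + 1)))) (?R5, u)"
    unfolding one_test_def by (rule exec.intros)+
  moreover have "?R5 (d + 2) = of_bool (input_symbol w (R (d + 1)) = 1)"
    using assms by (auto simp: input_symbol_def)
  ultimately show ?thesis by (intro exI[of _ ?R5]) (simp add: eval_nat_numeral)
qed

text \<open>Induction on the length of the remaining run of ones. Register \<open>d + 2\<close>
  holds the test of the symbol at the position in \<open>d + 1\<close> and is refreshed at the end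
  of each round.\<close>

lemma exec_ones_loop:
  assumes "R (d + 3) = 1" "R (d + 2) = of_bool (input_symbol w (R (d + 1)) = 1)"
  shows "\<exists>R'. exec w (WhileNZ (d + 2) (Seq (Add d d (d + 3)) (Seq (Add (d + 1) (d + 1) (d + 3))
      (one_test d)))) (R, u) (8 * ones w (R (d + 1)) + 1) (R', u) \<and>
      R' d = R d + ones w (R (d + 1)) \<and> (\<forall>r<d. R' r = R r)"
  using assms
proof (induction "ones w (R (d + 1))" arbitrary: R)
  case 0
  have "input_symbol w (R (d + 1)) \<noteq> 1"
    using 0 ones_rec[of w "R (d + 1)"] by (metis nat.distinct(1))
  then have "R (d + 2) = 0" using 0 by simp
  then show ?case using exec.WhileNZ_False[of R "d + 2" w _ u] 0 by force
next
  case (Suc k)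
  let ?R1 = "R(d := R d + R (d + 3))"
  let ?R2 = "?R1(d + 1 := ?R1 (d + 1) + ?R1 (d + 3))"
  have s: "input_symbol w (R (d + 1)) = 1"
    using Suc.hyps(2) ones_rec[of w "R (d + 1)"] by (simp split: if_splits)
  have k: "k = ones w (R (d + 1) + 1)"
    using Suc.hyps(2) ones_rec[of w "R (d + 1)"] s by simp
  obtain R3 where R3: "exec w (one_test d) (?R2, u) 5 (R3, u)"
      "R3 (d + 2) = of_bool (input_symbol w (?R2 (d + 1)) = 1)"
      "\<forall>r. r \<noteq> d + 2 \<longrightarrow> r \<noteq> d + 4 \<longrightarrow> R3 r = ?R2 r"
    using exec_one_test[of ?R2 d w u] Suc.prems by auto
  have R32: "R3 (d + 2) = of_bool (input_symbol w (R3 (d + 1)) = 1)" using R3(2,3) by simp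
  have b: "exec w (Seq (Add d d (d + 3)) (Seq (Add (d + 1) (d + 1) (d + 3)) (one_test d)))
      (R, u) (1 + (1 + 5)) (R3, u)"
    by (rule R3(1) exec.intros)+
  have R3': "R3 d = R d + 1" "R3 (d + 1) = R (d + 1) + 1" "R3 (d + 3) = 1" "\<forall>r<d. R3 r = R r"
    using R3(3) Suc.prems by auto
  obtain R' where R': "exec w (WhileNZ (d + 2) (Seq (Add d d (d + 3)) (Seq (Add (d + 1) (d + 1) (d + 3))
      (one_test d)))) (R3, u) (8 * ones w (R3 (d + 1)) + 1) (R', u)"
      "R' d = R3 d + ones w (R3 (d + 1))" "\<forall>r<d. R' r = R3 r"
    using Suc.hyps(1)[of R3] R3' R32 k by auto
  have run: "exec w (WhileNZ (d + 2) (Seq (Add d d (d + 3)) (Seq (Add (d + 1) (d + 1) (d + 3))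
      (one_test d)))) (R, u) (1 + (1 + 5) + (8 * ones w (R3 (d + 1)) + 1) + 1) (R', u)"
    using Suc.prems(2) s by (intro exec.WhileNZ_True[OF _ b R'(1)]) simp
  have T: "1 + (1 + 5) + (8 * ones w (R3 (d + 1)) + 1) + 1 = 8 * ones w (R (d + 1)) + 1"
    using R3' k Suc.hyps(2) by simp
  have "R' d = R d + ones w (R (d + 1))" using R'(2) R3' k Suc.hyps(2) by simp
  then show ?case using run[unfolded T] R'(3) R3'(4) by (intro exI[of _ R'] conjI) auto
qed

text \<open>The target \<open>d'\<close> varies above the fixed level \<open>d\<close> of the
  variables: a second operand is compiled one register higher and so spares the value of the
  first.\<close>

lemma exec_compile:
  assumes "regs_below d e" "d \<le> d'" "\<forall>r<d. R r \<le> B" "length w \<le> B"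
  shows "\<exists>t R'. exec w (compile e d') (R, u) t (R', u) \<and> t \<le> time_bound e B \<and>
    R' d' = eval w R e \<and> (\<forall>r<d'. R' r = R r)"
  using assms
proof (induction e arbitrary: d' R)
  case (Reg r)
  show ?case unfolding compile.simps by (intro exI conjI, rule exec.intros) auto
next
  case (Num k)
  show ?case unfolding compile.simps by (intro exI conjI, rule exec.intros) auto
next
  case (Plus e f)
  obtain t1 R1 where 1: "exec w (compile e d') (R, u) t1 (R1, u)" "t1 \<le> time_bound e B"
      "R1 d' = eval w R e" "\<forall>r<d'. R1 r = R r"
    using Plus.IH(1)[of d' R] Plus.prems by auto
  obtain t2 R2 where 2: "exec w (compile f (d' + 1)) (R1, u) t2 (R2, u)" "t2 \<le> time_bound f B"
      "R2 (d' + 1) = eval w R1 f" "\<forall>r<d' + 1. R2 r = R1 r"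
    using Plus.IH(2)[of "d' + 1" R1] Plus.prems 1(4) by auto
  have f: "eval w R1 f = eval w R f" using Plus.prems 1(4) by (intro eval_cong[of d]) auto
  have run: "exec w (compile (Plus e f) d') (R, u) (t1 + (t2 + 1)) (R2(d' := R2 d' + R2 (d' + 1)), u)"
    unfolding compile.simps by (rule 1(1) 2(1) exec.intros)+
  show ?case by (intro exI conjI, rule run) (use f 1(2-4) 2(2-4) in auto)
next
  case (Minus e f)
  obtain t1 R1 where 1: "exec w (compile e d') (R, u) t1 (R1, u)" "t1 \<le> time_bound e B"
      "R1 d' = eval w R e" "\<forall>r<d'. R1 r = R r"
    using Minus.IH(1)[of d' R] Minus.prems by auto
  obtain t2 R2 where 2: "exec w (compile f (d' + 1)) (R1, u) t2 (R2, u)" "t2 \<le> time_bound f B"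
      "R2 (d' + 1) = eval w R1 f" "\<forall>r<d' + 1. R2 r = R1 r"
    using Minus.IH(2)[of "d' + 1" R1] Minus.prems 1(4) by auto
  have f: "eval w R1 f = eval w R f" using Minus.prems 1(4) by (intro eval_cong[of d]) auto
  have run: "exec w (compile (Minus e f) d') (R, u) (t1 + (t2 + 1)) (R2(d' := R2 d' - R2 (d' + 1)), u)"
    unfolding compile.simps by (rule 1(1) 2(1) exec.intros)+
  show ?case by (intro exI conjI, rule run) (use f 1(2-4) 2(2-4) in auto)
next
  case (Times e f)
  obtain t1 R1 where 1: "exec w (compile e d') (R, u) t1 (R1, u)" "t1 \<le> time_bound e B"
      "R1 d' = eval w R e" "\<forall>r<d'. R1 r = R r"
    using Times.IH(1)[of d' R] Times.prems by auto
  obtain t2 R2 where 2: "exec w (compile f (d' + 1)) (R1, u) t2 (R2, u)" "t2 \<le> time_bound f B"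
      "R2 (d' + 1) = eval w R1 f" "\<forall>r<d' + 1. R2 r = R1 r"
    using Times.IH(2)[of "d' + 1" R1] Times.prems 1(4) by auto
  have f: "eval w R1 f = eval w R f" using Times.prems 1(4) by (intro eval_cong[of d]) auto
  let ?R3 = "R2(d' + 2 := 0, d' + 3 := 1)"
  obtain R4 where 4: "exec w (WhileNZ d' (Seq (Add (d' + 2) (d' + 2) (d' + 1)) (Sub d' d' (d' + 3))))
      (?R3, u) (3 * ?R3 d' + 1) (R4, u)" "R4 (d' + 2) = ?R3 (d' + 2) + ?R3 d' * ?R3 (d' + 1)"
      "\<forall>r<d'. R4 r = ?R3 r"
    using exec_multiply_loop[of ?R3 d' w u] by auto
  have v: "R2 d' = eval w R e" using 1(3) 2(4) by simp
  \<comment> \<open>The number of rounds is the value of the first factor, so bounding the time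
    takes a bound on values.\<close>
  have bound: "eval w R e \<le> value_bound e B" using Times.prems by (intro eval_le_value_bound[of d]) auto
  have run: "exec w (compile (Times e f) d') (R, u) (t1 + (t2 + (1 + (1 + (3 * ?R3 d' + 1 + 1)))))
      (R4(d' := R4 (d' + 2)), u)"
    unfolding compile.simps by (rule 1(1) 2(1) 4(1) exec.intros)+
  have T: "t1 + (t2 + (1 + (1 + (3 * ?R3 d' + 1 + 1)))) \<le> time_bound (Times e f) B"
    using 1(2) 2(2) bound by (simp add: v)
  show ?case by (intro exI conjI, rule run) (use T 1(4) 2(3,4) 4(2,3) v f in auto)
next
  case (Sym e)
  obtain t1 R1 where 1: "exec w (compile e d') (R, u) t1 (R1, u)" "t1 \<le> time_bound e B"
      "R1 d' = eval w R e" "\<forall>r<d'. R1 r = R r"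
    using Sym.IH[of d' R] Sym.prems by auto
  have run: "exec w (compile (Sym e) d') (R, u) (t1 + 1) (R1(d' := input_symbol w (R1 d')), u)"
    unfolding compile.simps by (rule 1(1) exec.intros)+
  show ?case by (intro exI conjI, rule run) (use 1(2-4) in auto)
next
  case (Ones e)
  obtain t1 R1 where 1: "exec w (compile e (d' + 1)) (R, u) t1 (R1, u)" "t1 \<le> time_bound e B"
      "R1 (d' + 1) = eval w R e" "\<forall>r<d' + 1. R1 r = R r"
    using Ones.IH[of "d' + 1" R] Ones.prems by auto
  let ?R2 = "R1(d' := 0, d' + 3 := 1)"
  obtain R3 where 3: "exec w (one_test d') (?R2, u) 5 (R3, u)"
      "R3 (d' + 2) = of_bool (input_symbol w (?R2 (d' + 1)) = 1)"
      "\<forall>r. r \<noteq> d' + 2 \<longrightarrow> r \<noteq> d' + 4 \<longrightarrow> R3 r = ?R2 r"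
    using exec_one_test[of ?R2 d' w u] by auto
  have R3: "R3 (d' + 1) = eval w R e" "R3 (d' + 3) = 1" "R3 d' = 0" "\<forall>r<d'. R3 r = R r"
    using 3(3) 1 by auto
  obtain R4 where 4: "exec w (WhileNZ (d' + 2) (Seq (Add d' d' (d' + 3)) (Seq (Add (d' + 1) (d' + 1) (d' + 3))
      (one_test d')))) (R3, u) (8 * ones w (R3 (d' + 1)) + 1) (R4, u)"
      "R4 d' = R3 d' + ones w (R3 (d' + 1))" "\<forall>r<d'. R4 r = R3 r"
    using exec_ones_loop[of R3 d' w u] R3 3 by auto
  have run: "exec w (compile (Ones e) d') (R, u) (t1 + (1 + (1 + (5 + (8 * ones w (R3 (d' + 1)) + 1))))) (R4, u)"
    unfolding compile.simps by (rule 1(1) 3(1) 4(1) exec.intros)+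
  have T: "t1 + (1 + (1 + (5 + (8 * ones w (R3 (d' + 1)) + 1)))) \<le> time_bound (Ones e) B"
    using 1(2) ones_le_length[of w "R3 (d' + 1)"] Ones.prems by simp
  show ?case by (intro exI conjI, rule run) (use T R3 4(2,3) in auto)
next
  case (Cond e f g)
  obtain t1 R1 where 1: "exec w (compile e d') (R, u) t1 (R1, u)" "t1 \<le> time_bound e B"
      "R1 d' = eval w R e" "\<forall>r<d'. R1 r = R r"
    using Cond.IH(1)[of d' R] Cond.prems by auto
  have eq: "eval w R1 f = eval w R f" "eval w R1 g = eval w R g"
    using Cond.prems 1(4) by (auto intro!: eval_cong[of d])
  show ?case
  proof (cases "eval w R e = 0")
    case True
    obtain t2 R2 where 2: "exec w (compile g d') (R1, u) t2 (R2, u)" "t2 \<le> time_bound g B"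
        "R2 d' = eval w R1 g" "\<forall>r<d'. R2 r = R1 r"
      using Cond.IH(3)[of d' R1] Cond.prems 1(4) by auto
    have run: "exec w (compile (Cond e f g) d') (R, u) (t1 + (t2 + 1)) (R2, u)"
      unfolding compile.simps using 1 True by (intro exec.Seq[OF 1(1)] exec.IfNZ_False 2(1)) simp
    show ?thesis by (intro exI conjI, rule run) (use 1 2 eq True in auto)
  next
    case False
    obtain t2 R2 where 2: "exec w (compile f d') (R1, u) t2 (R2, u)" "t2 \<le> time_bound f B"
        "R2 d' = eval w R1 f" "\<forall>r<d'. R2 r = R1 r"
      using Cond.IH(2)[of d' R1] Cond.prems 1(4) by auto
    have run: "exec w (compile (Cond e f g) d') (R, u) (t1 + (t2 + 1)) (R2, u)"
      unfolding compile.simps using 1 False by (intro exec.Seq[OF 1(1)] exec.IfNZ_True 2(1)) simp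
    show ?thesis by (intro exI conjI, rule run) (use 1 2 eq False in auto)
  qed
qed

section \<open>Statements with bounded loops and their compilation\<close>

datatype stmt =
    Print expr
  | Then stmt stmt
  | Bind expr stmt
  | For expr stmt

text \<open>A statement is interpreted at a level \<open>d\<close>, the number of registers in use. \<open>Bind\<close> binds
  register \<open>d\<close>; \<open>For\<close> binds \<open>d\<close> to the loop index and \<open>d + 1\<close> to the number of iterations.\<close>

primrec printed :: "bool list \<Rightarrow> stmt \<Rightarrow> nat \<Rightarrow> (nat \<Rightarrow> nat) \<Rightarrow> bool list" where
  "printed w (Print e) d R = [eval w R e \<noteq> 0]"
| "printed w (Then s1 s2) d R = printed w s1 d R @ printed w s2 d R"
| "printed w (Bind e s) d R = printed w s (d + 1) (R(d := eval w R e))"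
| "printed w (For e s) d R =
    concat (map (\<lambda>k. printed w s (d + 2) (R(d := k, d + 1 := eval w R e))) [0..<eval w R e])"

primrec closed :: "nat \<Rightarrow> stmt \<Rightarrow> bool" where
  "closed d (Print e) \<longleftrightarrow> regs_below d e"
| "closed d (Then s1 s2) \<longleftrightarrow> closed d s1 \<and> closed d s2"
| "closed d (Bind e s) \<longleftrightarrow> regs_below d e \<and> closed (d + 1) s"
| "closed d (For e s) \<longleftrightarrow> regs_below d e \<and> closed (d + 2) s"

text \<open>A loop body may overwrite every register from \<open>d + 2\<close> on. Only the index
  and the number of iterations survive, so the loop test is recomputed as their difference.\<close>

primrec compile_stmt :: "stmt \<Rightarrow> nat \<Rightarrow> prog" where
  "compile_stmt (Print e) d = Seq (compile e d) (IfNZ d (Emit True) (Emit False))"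
| "compile_stmt (Then s1 s2) d = Seq (compile_stmt s1 d) (compile_stmt s2 d)"
| "compile_stmt (Bind e s) d = Seq (compile e d) (compile_stmt s (d + 1))"
| "compile_stmt (For e s) d =
    Seq (compile e (d + 1)) (Seq (Const d 0) (Seq (Sub (d + 2) (d + 1) d)
      (WhileNZ (d + 2) (Seq (compile_stmt s (d + 2)) (Seq (Const (d + 2) 1)
        (Seq (Add d d (d + 2)) (Sub (d + 2) (d + 1) d)))))))"

text \<open>Under a binder the register bound grows by \<open>value_bound e B\<close> to cover the
  new registers. In a loop, 3 pays for the initialization and the final test, 4 for index update and
  test in each round.\<close>

primrec stmt_time_bound :: "stmt \<Rightarrow> nat \<Rightarrow> nat" where
  "stmt_time_bound (Print e) B = time_bound e B + 2"
| "stmt_time_bound (Then s1 s2) B = stmt_time_bound s1 B + stmt_time_bound s2 B"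
| "stmt_time_bound (Bind e s) B = time_bound e B + stmt_time_bound s (B + value_bound e B)"
| "stmt_time_bound (For e s) B =
    time_bound e B + 3 + value_bound e B * (stmt_time_bound s (B + value_bound e B) + 4)"

lemma printed_cong: "closed d s \<Longrightarrow> \<forall>r<d. R r = R' r \<Longrightarrow> printed w s d R = printed w s d R'"
proof (induction s arbitrary: d R R')
  case (Print e)
  then show ?case using eval_cong[of d e R R' w] by simp
next
  case (Then s1 s2)
  then show ?case by (metis closed.simps(2) printed.simps(2))
next
  case (Bind e s)
  have "eval w R e = eval w R' e" using Bind.prems eval_cong[of d e R R' w] by simp
  then show ?case using Bind.prems by (auto intro!: Bind.IH simp: less_Suc_eq)
next
  case (For e s)
  have e: "eval w R e = eval w R' e" using For.prems eval_cong[of d e R R' w] by simp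
  have "printed w s (d + 2) (R(d := k, d + 1 := eval w R e)) =
      printed w s (d + 2) (R'(d := k, d + 1 := eval w R' e))" for k
    unfolding e using For.prems by (intro For.IH) auto
  then show ?case using e by simp
qed

text \<open>The induction generalizes \<open>B\<close> and \<open>u\<close>, because binders raise
  the register bound and earlier statements lengthen the output.\<close>

lemma exec_compile_stmt:
  assumes "closed d s" "\<forall>r<d. R r \<le> B" "length w \<le> B"
  shows "\<exists>t R'. exec w (compile_stmt s d) (R, u) t (R', u @ printed w s d R) \<and>
    t \<le> stmt_time_bound s B \<and> (\<forall>r<d. R' r = R r)"
  using assms
proof (induction s arbitrary: d R B u)
  case (Print e)
  obtain t R1 where 1: "exec w (compile e d) (R, u) t (R1, u)" "t \<le> time_bound e B"
      "R1 d = eval w R e" "\<forall>r<d. R1 r = R r"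
    using exec_compile[of d e d R B w u] Print.prems by auto
  have "exec w (IfNZ d (Emit True) (Emit False)) (R1, u) (1 + 1) (R1, u @ printed w (Print e) d R)"
  proof (cases "eval w R e = 0")
    case True
    then show ?thesis using 1(3) exec.Emit[of w False R1 u] by (intro exec.IfNZ_False) auto
  next
    case False
    then show ?thesis using 1(3) exec.Emit[of w True R1 u] by (intro exec.IfNZ_True) auto
  qed
  from exec.Seq[OF 1(1) this] have run: "exec w (compile_stmt (Print e) d) (R, u) (t + (1 + 1))
      (R1, u @ printed w (Print e) d R)" by simp
  show ?case by (intro exI conjI, rule run) (use 1 in auto)
next
  case (Then s1 s2)
  obtain t1 R1 where 1: "exec w (compile_stmt s1 d) (R, u) t1 (R1, u @ printed w s1 d R)"
      "t1 \<le> stmt_time_bound s1 B" "\<forall>r<d. R1 r = R r"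
    using Then.IH(1)[of d R B u] Then.prems by auto
  obtain t2 R2 where 2: "exec w (compile_stmt s2 d) (R1, u @ printed w s1 d R) t2
        (R2, (u @ printed w s1 d R) @ printed w s2 d R1)"
      "t2 \<le> stmt_time_bound s2 B" "\<forall>r<d. R2 r = R1 r"
    using Then.IH(2)[of d R1 B "u @ printed w s1 d R"] Then.prems 1(3) by auto
  have "printed w s2 d R1 = printed w s2 d R" using 1(3) Then.prems by (intro printed_cong) auto
  then have run: "exec w (compile_stmt (Then s1 s2) d) (R, u) (t1 + t2)
      (R2, u @ printed w (Then s1 s2) d R)" using exec.Seq[OF 1(1) 2(1)] by simp
  show ?case by (intro exI conjI, rule run) (use 1 2 in auto)
next
  case (Bind e s)
  obtain t1 R1 where 1: "exec w (compile e d) (R, u) t1 (R1, u)" "t1 \<le> time_bound e B"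
      "R1 d = eval w R e" "\<forall>r<d. R1 r = R r"
    using exec_compile[of d e d R B w u] Bind.prems by auto
  have v: "eval w R e \<le> value_bound e B" using Bind.prems by (intro eval_le_value_bound[of d]) auto
  obtain t2 R2 where 2: "exec w (compile_stmt s (d + 1)) (R1, u) t2 (R2, u @ printed w s (d + 1) R1)"
      "t2 \<le> stmt_time_bound s (B + value_bound e B)" "\<forall>r<d + 1. R2 r = R1 r"
    using Bind.IH[of "d + 1" R1 "B + value_bound e B" u] Bind.prems 1(3,4) v
    by (auto simp: less_Suc_eq trans_le_add1 trans_le_add2)
  have "printed w s (d + 1) R1 = printed w s (d + 1) (R(d := eval w R e))"
    using 1 Bind.prems by (intro printed_cong) (auto simp: less_Suc_eq)
  then have run: "exec w (compile_stmt (Bind e s) d) (R, u) (t1 + t2)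
      (R2, u @ printed w (Bind e s) d R)" using exec.Seq[OF 1(1) 2(1)] by simp
  show ?case by (intro exI conjI, rule run) (use 1 2 in auto)
next
  case (For e s)
  define n where "n = eval w R e"
  define C where "C = B + value_bound e B"
  define out where "out = (\<lambda>k. printed w s (d + 2) (R(d := k, d + 1 := n)))"
  define body where "body = Seq (compile_stmt s (d + 2)) (Seq (Const (d + 2) 1)
        (Seq (Add d d (d + 2)) (Sub (d + 2) (d + 1) d)))"
  have v: "n \<le> value_bound e B"
    unfolding n_def using For.prems by (intro eval_le_value_bound[of d]) auto
  \<comment> \<open>With \<open>m\<close> rounds to go the index is \<open>n - m\<close>, and the
    outputs for the indices from \<open>n - m\<close> on are still to be printed.\<close>
  have loop: "\<exists>t R'. exec w (WhileNZ (d + 2) body) (R1, u) t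
        (R', u @ concat (map out [n - m..<n])) \<and>
      t \<le> m * (stmt_time_bound s C + 4) + 1 \<and> (\<forall>r<d. R' r = R r)"
    if "m \<le> n" "R1 (d + 2) = m" "R1 d = n - m" "R1 (d + 1) = n" "\<forall>r<d. R1 r = R r" for m R1 u
    using that
  proof (induction m arbitrary: R1 u)
    case 0
    then show ?case using exec.WhileNZ_False[of R1 "d + 2" w body u] by force
  next
    case (Suc m)
    have bd: "\<forall>r<d + 2. R1 r \<le> C"
      using Suc.prems v For.prems by (auto simp: less_Suc_eq C_def trans_le_add1)
    obtain t2 R2 where 2: "exec w (compile_stmt s (d + 2)) (R1, u) t2 (R2, u @ printed w s (d + 2) R1)"
        "t2 \<le> stmt_time_bound s C" "\<forall>r<d + 2. R2 r = R1 r"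
      using For.IH[of "d + 2" R1 C u] For.prems bd by (auto simp: C_def)
    have o: "printed w s (d + 2) R1 = out (n - Suc m)"
      unfolding out_def using Suc.prems For.prems by (intro printed_cong) (auto simp: less_Suc_eq)
    let ?R3 = "R2(d + 2 := 1)"
    let ?R4 = "?R3(d := ?R3 d + ?R3 (d + 2))"
    let ?R5 = "?R4(d + 2 := ?R4 (d + 1) - ?R4 d)"
    have b: "exec w body (R1, u) (t2 + (1 + (1 + 1))) (?R5, u @ out (n - Suc m))"
      unfolding body_def o[symmetric] by (rule 2(1) exec.intros)+
    have nm: "n - m = Suc (n - Suc m)" using Suc.prems by simp
    have "?R5 (d + 2) = m" "?R5 d = n - m" "?R5 (d + 1) = n" "\<forall>r<d. ?R5 r = R r"
      using Suc.prems 2(3) nm by auto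
    then obtain t3 R' where 3: "exec w (WhileNZ (d + 2) body) (?R5, u @ out (n - Suc m)) t3
        (R', (u @ out (n - Suc m)) @ concat (map out [n - m..<n]))"
        "t3 \<le> m * (stmt_time_bound s C + 4) + 1" "\<forall>r<d. R' r = R r"
      using Suc.IH[of ?R5 "u @ out (n - Suc m)"] Suc.prems(1) by (metis Suc_leD)
    have "exec w (WhileNZ (d + 2) body) (R1, u) (t2 + (1 + (1 + 1)) + t3 + 1)
        (R', (u @ out (n - Suc m)) @ concat (map out [n - m..<n]))"
      using Suc.prems by (intro exec.WhileNZ_True[OF _ b 3(1)]) simp
    moreover have "[n - Suc m..<n] = (n - Suc m) # [n - m..<n]"
      using Suc.prems upt_conv_Cons[of "n - Suc m" n] nm by simp
    ultimately have run: "exec w (WhileNZ (d + 2) body) (R1, u) (t2 + (1 + (1 + 1)) + t3 + 1)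
        (R', u @ concat (map out [n - Suc m..<n]))" by simp
    show ?case by (intro exI conjI, rule run) (use 2(2) 3 in auto)
  qed
  obtain t1 R1 where 1: "exec w (compile e (d + 1)) (R, u) t1 (R1, u)" "t1 \<le> time_bound e B"
      "R1 (d + 1) = n" "\<forall>r<d + 1. R1 r = R r"
    using exec_compile[of d e "d + 1" R B w u] For.prems by (auto simp: n_def)
  let ?R2 = "R1(d := 0)"
  let ?R3 = "?R2(d + 2 := ?R2 (d + 1) - ?R2 d)"
  obtain t2 R' where 2: "exec w (WhileNZ (d + 2) body) (?R3, u) t2
      (R', u @ concat (map out [n - n..<n]))" "t2 \<le> n * (stmt_time_bound s C + 4) + 1"
      "\<forall>r<d. R' r = R r"
    using loop[of n ?R3 u] 1(3,4) by auto
  have run: "exec w (compile_stmt (For e s) d) (R, u) (t1 + (1 + (1 + t2)))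
      (R', u @ concat (map out [n - n..<n]))"
    unfolding compile_stmt.simps body_def[symmetric] by (rule 1(1) 2(1) exec.intros)+
  have T: "t1 + (1 + (1 + t2)) \<le> stmt_time_bound (For e s) B"
    using 1(2) 2(2) mult_le_mono1[OF v, of "stmt_time_bound s C + 4"]
    unfolding stmt_time_bound.simps C_def by linarith
  have o: "concat (map out [n - n..<n]) = printed w (For e s) d R"
    by (simp add: out_def n_def)
  show ?case by (intro exI conjI, rule run[unfolded o]) (use T 1(4) 2(3) in auto)
qed

section \<open>Polynomial bounds on running times\<close>

definition poly_bounded :: "(nat \<Rightarrow> nat) \<Rightarrow> bool" where
  "poly_bounded f \<longleftrightarrow> (\<exists>p :: nat poly. \<forall>n. f n \<le> poly p n)"

lemma poly_nat_mono: "m \<le> n \<Longrightarrow> poly p m \<le> poly (p :: nat poly) n"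
  by (induction p) (auto intro: add_mono mult_mono)

lemma poly_bounded_const: "poly_bounded (\<lambda>n. k)"
  unfolding poly_bounded_def by (intro exI[of _ "[:k:]"]) simp

lemma poly_bounded_id: "poly_bounded (\<lambda>n. n)"
  unfolding poly_bounded_def by (intro exI[of _ "[:0, 1:]"]) simp

lemma poly_bounded_add: "poly_bounded f \<Longrightarrow> poly_bounded g \<Longrightarrow> poly_bounded (\<lambda>n. f n + g n)"
  unfolding poly_bounded_def by (metis add_mono poly_add)

lemma poly_bounded_mult: "poly_bounded f \<Longrightarrow> poly_bounded g \<Longrightarrow> poly_bounded (\<lambda>n. f n * g n)"
  unfolding poly_bounded_def by (metis mult_le_mono poly_mult)

text \<open>The polynomial bounding \<open>f\<close> is monotone because its coefficients are
  natural numbers, so the bound for \<open>g\<close> may be substituted into it.\<close>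

lemma poly_bounded_compose:
  assumes "poly_bounded f" "poly_bounded g"
  shows "poly_bounded (\<lambda>n. f (g n))"
proof -
  obtain p q where "\<And>n. f n \<le> poly p n" "\<And>n. g n \<le> poly q n"
    using assms unfolding poly_bounded_def by blast
  then have "f (g n) \<le> poly (pcompose p q) n" for n
    by (metis le_trans poly_nat_mono poly_pcompose)
  then show ?thesis unfolding poly_bounded_def by blast
qed

lemma poly_bounded_Suc: "poly_bounded f \<Longrightarrow> poly_bounded (\<lambda>n. Suc (f n))"
  using poly_bounded_add[OF poly_bounded_const[of 1], of f] by simp

lemmas poly_bounded_intros = poly_bounded_Suc poly_bounded_const poly_bounded_id poly_bounded_add poly_bounded_mult

lemma poly_bounded_value_bound: "poly_bounded (value_bound e)"
  by (induction e) (auto intro: poly_bounded_intros)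

lemma poly_bounded_time_bound: "poly_bounded (time_bound e)"
  by (induction e) (auto intro!: poly_bounded_intros poly_bounded_value_bound)

text \<open>Each binder substitutes a polynomial for the register bound, and a fixed statement has
  finitely many binders.\<close>

lemma poly_bounded_stmt_time_bound: "poly_bounded (stmt_time_bound s)"
proof (induction s)
  case (Bind e s)
  have "poly_bounded (\<lambda>n. stmt_time_bound s (n + value_bound e n))"
    by (rule poly_bounded_compose[OF Bind.IH]) (intro poly_bounded_intros poly_bounded_value_bound)
  then show ?case using poly_bounded_time_bound by (auto intro!: poly_bounded_intros)
next
  case (For e s)
  have "poly_bounded (\<lambda>n. stmt_time_bound s (n + value_bound e n))"
    by (rule poly_bounded_compose[OF For.IH]) (intro poly_bounded_intros poly_bounded_value_bound)
  then show ?case using poly_bounded_time_bound poly_bounded_value_bound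
    unfolding stmt_time_bound.simps by (intro poly_bounded_intros) auto
qed (auto intro!: poly_bounded_intros poly_bounded_time_bound)

text \<open>At level 0 no register is in use, so the input length alone serves as the bound
  \<open>B\<close>. Polynomial time thus comes down to an equation about printed words.\<close>

theorem polytime_computable_stmt:
  assumes "closed 0 s" "\<And>a. a \<in> D \<Longrightarrow> printed (enc a) s 0 (\<lambda>_. 0) = enc' (F a)"
  shows "polytime_computable D enc enc' F"
proof -
  obtain p where p: "\<And>n. stmt_time_bound s n \<le> poly p n"
    using poly_bounded_stmt_time_bound unfolding poly_bounded_def by blast
  have "runs_within (compile_stmt s 0) (enc a) (enc' (F a)) (poly p (length (enc a)))" if "a \<in> D" for a
    using exec_compile_stmt[of 0 s "\<lambda>_. 0" "length (enc a)" "enc a" "[]"] assms(1) assms(2)[OF that]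
      p[of "length (enc a)"]
    unfolding runs_within_def by (auto intro: le_trans)
  then show ?thesis unfolding polytime_computable_def by blast
qed

section \<open>The program of the reduction\<close>

definition unary_stmt :: "expr \<Rightarrow> stmt" where
  "unary_stmt e = Then (For e (Print (Num 1))) (Print (Num 0))"

lemma printed_unary_stmt: "printed w (unary_stmt e) d R = encode_unary (eval w R e)"
proof -
  have "concat (map (\<lambda>k. [True]) [0..<n]) = replicate n True" for n
    by (induction n) (simp_all add: replicate_append_same)
  then show ?thesis by (simp add: unary_stmt_def encode_unary_def)
qed

text \<open>The cases are those of \<open>glued_order\<close>. \<open>Minus a b\<close> is nonzero
  exactly when \<open>b < a\<close>, and the sum of the two opposite differences exactly when the
  numbers differ. The second matrix is read with swapped indices, for the dual.\<close>

definition entry_expr :: "expr \<Rightarrow> expr \<Rightarrow> expr \<Rightarrow> expr \<Rightarrow> expr \<Rightarrow> expr \<Rightarrow> expr \<Rightarrow> expr \<Rightarrow> expr \<Rightarrow> expr" where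
  "entry_expr n1 m1 x1 n2 m2 x2 N i j =
    Cond (Minus n1 i)
      (Cond (Minus n1 j) (Sym (Plus (Plus m1 (Times i n1)) j)) (Num 0))
      (Cond (Minus (Plus n1 n2) i)
        (Cond (Minus n1 j)
          (Plus (Plus (Minus i (Plus n1 x2)) (Minus (Plus n1 x2) i)) (Plus (Minus j x1) (Minus x1 j)))
          (Cond (Minus (Plus n1 n2) j)
            (Sym (Plus (Plus m2 (Times (Minus j n1) n2)) (Minus i n1))) (Num 0)))
        (Cond (Minus (Plus n1 N) i) (Minus i j) (Minus n1 j)))"

text \<open>Register \<open>d + 1\<close> holds the position in the input at which the matrix starts.\<close>

definition holds_pointed :: "bool list \<Rightarrow> (nat \<Rightarrow> nat) \<Rightarrow> nat \<Rightarrow> pointed \<Rightarrow> bool" where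
  "holds_pointed w R d a \<longleftrightarrow> R d = card (fst (fst a)) \<and> R (d + 2) = snd a \<and>
    (\<forall>i<R d. \<forall>j<R d. input_symbol w (R (d + 1) + i * R d + j) = of_bool ((i, j) \<in> snd (fst a)))"

text \<open>The posets are stored from registers \<open>k\<close> and \<open>l\<close> on, and
  \<open>N\<close> in \<open>d - 1\<close>. A loop takes two registers, so the row index is in
  \<open>d\<close> and the column index in \<open>d + 2\<close>.\<close>

definition glue_stmt :: "nat \<Rightarrow> nat \<Rightarrow> nat \<Rightarrow> stmt" where
  "glue_stmt k l d = (let total = Plus (Plus (Reg k) (Reg (d - 1))) (Num 1) in
     Then (unary_stmt total)
       (Then (For total (For total (Print (entry_expr (Reg k) (Reg (k + 1)) (Reg (k + 2))
            (Reg l) (Reg (l + 1)) (Reg (l + 2)) (Reg (d - 1)) (Reg d) (Reg (d + 2))))))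
         (unary_stmt (Plus (Reg k) (Reg (d - 1))))))"

text \<open>The inequalities on \<open>d\<close> keep the stored posets apart from the register of
  \<open>N\<close> and from those of the loops.\<close>

lemma printed_glue_stmt:
  assumes d: "k + 3 < d" "l + 3 < d"
    and k: "holds_pointed w R k ((X1, r1), x1)" and l: "holds_pointed w R l ((X2, r2), x2)"
    and N: "R (d - 1) = N"
  shows "printed w (glue_stmt k l d) d R = encode_pointed (glue ((X1, r1), x1) ((X2, r2), x2) N)"
proof -
  define n1 n2 where "n1 = card X1" and "n2 = card X2"
  define total where "total = n1 + N + 1"
  have R: "R k = n1" "R (k + 2) = x1" "R l = n2" "R (l + 2) = x2"
    and s1: "\<And>i j. i < n1 \<Longrightarrow> j < n1 \<Longrightarrow> input_symbol w (R (k + 1) + i * n1 + j) = of_bool ((i, j) \<in> r1)"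
    and s2: "\<And>i j. i < n2 \<Longrightarrow> j < n2 \<Longrightarrow> input_symbol w (R (l + 1) + i * n2 + j) = of_bool ((i, j) \<in> r2)"
    using k l by (auto simp: holds_pointed_def n1_def n2_def)
  let ?S = "\<lambda>i j. R(d := i, d + 1 := total, d + 2 := j, d + 3 := total)"
  have entry: "eval w (?S i j) (entry_expr (Reg k) (Reg (k + 1)) (Reg (k + 2))
        (Reg l) (Reg (l + 1)) (Reg (l + 2)) (Reg (d - 1)) (Reg d) (Reg (d + 2))) \<noteq> 0 \<longleftrightarrow>
      (i, j) \<in> glued_order n1 r1 x1 n2 r2 x2 N" if "i < total" "j < total" for i j
  proof -
    have S: "?S i j k = n1" "?S i j (k + 1) = R (k + 1)" "?S i j (k + 2) = x1"
        "?S i j l = n2" "?S i j (l + 1) = R (l + 1)" "?S i j (l + 2) = x2" "?S i j (d - 1) = N"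
        "?S i j d = i" "?S i j (d + 2) = j"
      using d R N by auto
    have 1: "input_symbol w (R (k + 1) + i * n1 + j) = of_bool ((i, j) \<in> r1)" if "i < n1" "j < n1"
      using s1 that by simp
    have 2: "input_symbol w (R (l + 1) + (j - n1) * n2 + (i - n1)) = of_bool ((j - n1, i - n1) \<in> r2)"
      if "n1 \<le> i" "n1 \<le> j" "i < n1 + n2" "j < n1 + n2"
      using s2[of "j - n1" "i - n1"] that by auto
    show ?thesis
      unfolding entry_expr_def eval.simps S glued_order_def using that 1 2
      by (auto simp: total_def)
  qed
  have tot: "eval w R' (Plus (Plus (Reg k) (Reg (d - 1))) (Num 1)) = total"
    if "R' k = n1" "R' (d - 1) = N" for R' using that by (simp add: total_def)
  have inner: "concat (map (\<lambda>j. [f j]) xs) = map f xs" for f :: "nat \<Rightarrow> bool" and xs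
    by (induction xs) auto
  have "printed w (For (Plus (Plus (Reg k) (Reg (d - 1))) (Num 1))
      (For (Plus (Plus (Reg k) (Reg (d - 1))) (Num 1)) (Print (entry_expr (Reg k) (Reg (k + 1)) (Reg (k + 2))
        (Reg l) (Reg (l + 1)) (Reg (l + 2)) (Reg (d - 1)) (Reg d) (Reg (d + 2)))))) d R =
    concat (map (\<lambda>i. map (\<lambda>j. eval w (?S i j) (entry_expr (Reg k) (Reg (k + 1)) (Reg (k + 2))
        (Reg l) (Reg (l + 1)) (Reg (l + 2)) (Reg (d - 1)) (Reg d) (Reg (d + 2))) \<noteq> 0) [0..<total]) [0..<total])"
  proof -
    have t1: "eval w R (Plus (Plus (Reg k) (Reg (d - 1))) (Num 1)) = total"
      and t2: "eval w (R(d := i, d + 1 := total)) (Plus (Plus (Reg k) (Reg (d - 1))) (Num 1)) = total" for i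
      using d R N by (auto simp: total_def)
    have "d + 2 + 1 = d + 3" by simp
    then show ?thesis unfolding printed.simps t1 t2 inner by (simp only:)
  qed
  also have "\<dots> = concat (map (\<lambda>i. map (\<lambda>j. (i, j) \<in> glued_order n1 r1 x1 n2 r2 x2 N) [0..<total]) [0..<total])"
    using entry by (intro arg_cong[of _ _ concat] map_cong refl) auto
  finally show ?thesis
    using R N unfolding glue_stmt_def
    by (simp add: Let_def printed_unary_stmt encode_pointed_def n1_def n2_def total_def del: printed.simps(4))
qed

section \<open>Reading the four posets from the input\<close>

text \<open>The number \<open>k\<close> of rows is separate from their length \<open>n\<close>, so
  that induction can add one row at a time.\<close>

lemma matrix_concat:
  "length (concat (map (\<lambda>i. map (f i) [0..<n]) [0..<k])) = k * n"
  "i < k \<Longrightarrow> j < n \<Longrightarrow> concat (map (\<lambda>i. map (f i) [0..<n]) [0..<k]) ! (i * n + j) = f i j"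
proof -
  show len: "length (concat (map (\<lambda>i. map (f i) [0..<n]) [0..<k])) = k * n" for k
    by (induction k) auto
  show "i < k \<Longrightarrow> j < n \<Longrightarrow> concat (map (\<lambda>i. map (f i) [0..<n]) [0..<k]) ! (i * n + j) = f i j"
  proof (induction k)
    case (Suc k)
    show ?case
    proof (cases "i = k")
      case True
      then show ?thesis using Suc.prems len[of k] by (simp add: nth_append)
    next
      case False
      then have "i < k" using Suc.prems by simp
      moreover have "i * n + j < k * n"
        using mult_le_mono1[of "Suc i" k n] \<open>i < k\<close> Suc.prems by simp
      ultimately show ?thesis using Suc len[of k] by (simp add: nth_append)
    qed
  qed simp
qed

lemma ones_encode_unary: "ones (pre @ encode_unary k @ post) (length pre) = k"
proof -
  have "takeWhile id (replicate k True @ False # post) = replicate k True" by (induction k) auto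
  then show ?thesis by (simp add: ones_def encode_unary_def)
qed

text \<open>Registers \<open>d\<close>, \<open>d + 1\<close> and \<open>d + 2\<close> receive the
  size, the start of the matrix and the distinguished element. The added 1 skips the
  \<open>False\<close> that ends a unary number.\<close>

definition parse_stmt :: "expr \<Rightarrow> nat \<Rightarrow> stmt \<Rightarrow> stmt" where
  "parse_stmt pos d s = Bind (Ones pos) (Bind (Plus (Plus pos (Reg d)) (Num 1))
     (Bind (Ones (Plus (Reg (d + 1)) (Times (Reg d) (Reg d)))) s))"

definition next_expr :: "nat \<Rightarrow> expr" where
  "next_expr d = Plus (Plus (Plus (Reg (d + 1)) (Times (Reg d) (Reg d))) (Reg (d + 2))) (Num 1)"

text \<open>\<open>R'\<close> is chosen independently of the continuation \<open>s\<close>, so that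
  parses can be chained; the last fact supplies the starting position of the next one.\<close>

lemma printed_parse_stmt:
  assumes w: "w = pre @ encode_pointed a @ post" and pos: "eval w R pos = length pre" "regs_below d pos"
  obtains R' where "\<And>s. printed w (parse_stmt pos d s) d R = printed w s (d + 3) R'"
    "holds_pointed w R' d a" "\<And>r. r < d \<Longrightarrow> R' r = R r"
    "eval w R' (next_expr d) = length (pre @ encode_pointed a)"
proof -
  obtain X r x where a: "a = ((X, r), x)" by (metis prod.exhaust)
  define n where "n = card X"
  define M where "M = concat (map (\<lambda>i. map (\<lambda>j. (i, j) \<in> r) [0..<n]) [0..<n])"
  have enc: "encode_pointed a = encode_unary n @ M @ encode_unary x"
    by (simp add: a encode_pointed_def n_def M_def Let_def)
  have lu: "length (encode_unary k) = k + 1" for k by (simp add: encode_unary_def)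
  have lM: "length M = n * n" unfolding M_def by (rule matrix_concat)
  have on: "ones w (length pre) = n" unfolding w enc using ones_encode_unary by simp
  have ox: "ones w (length pre + n + 1 + n * n) = x"
    using ones_encode_unary[of "pre @ encode_unary n @ M" x post] by (simp add: w enc lu lM add.assoc)
  define R1 where "R1 = R(d := n)"
  define R2 where "R2 = R1(d + 1 := length pre + n + 1)"
  define R' where "R' = R2(d + 2 := x)"
  \<comment> \<open>\<open>pos\<close> is evaluated a second time, after register \<open>d\<close>
    has been set.\<close>
  have "eval w R1 pos = length pre"
    unfolding pos(1)[symmetric] R1_def using pos(2) by (intro eval_cong) auto
  then have "printed w (parse_stmt pos d s) d R = printed w s (d + 3) R'" for s
    using pos(1) on ox by (simp add: parse_stmt_def R1_def R2_def R'_def eval_nat_numeral)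
  moreover have "holds_pointed w R' d a"
  proof -
    have "input_symbol w (length pre + n + 1 + i * n + j) = of_bool ((i, j) \<in> r)"
      if "i < n" "j < n" for i j
    proof -
      have lt: "i * n + j < n * n" using mult_le_mono1[of "Suc i" n n] that by simp
      have "w ! (length (pre @ encode_unary n) + (i * n + j)) = M ! (i * n + j)"
        using nth_append_length_plus[of "pre @ encode_unary n" "M @ encode_unary x @ post" "i * n + j"] lt lM
        by (simp add: w enc nth_append)
      then have "w ! (length pre + n + 1 + i * n + j) = ((i, j) \<in> r)"
        using matrix_concat(2)[OF that, of "\<lambda>i j. (i, j) \<in> r"] by (simp add: lu M_def add.assoc)
      moreover have "length pre + n + 1 + i * n + j < length w" using lt by (simp add: w enc lu lM)
      ultimately show ?thesis by (simp add: input_symbol_def)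
    qed
    then show ?thesis by (simp add: holds_pointed_def a R'_def R2_def R1_def n_def)
  qed
  moreover have "\<And>r. r < d \<Longrightarrow> R' r = R r" by (simp add: R'_def R2_def R1_def)
  moreover have "eval w R' (next_expr d) = length (pre @ encode_pointed a)"
    by (simp add: next_expr_def enc lu lM R'_def R2_def R1_def)
  ultimately show ?thesis by (rule that)
qed

text \<open>The posets occupy registers from 0, 3, 6 and 9 on, and register 12 holds
  \<open>N\<close>. The maximum of \<open>a\<close> and \<open>b\<close> is computed as
  \<open>a + (b - a)\<close> with truncated subtraction.\<close>

definition reduction_stmt :: stmt where
  "reduction_stmt = parse_stmt (Num 0) 0 (parse_stmt (next_expr 0) 3 (parse_stmt (next_expr 3) 6
     (parse_stmt (next_expr 6) 9 (Bind (Plus (Reg 3) (Minus (Reg 6) (Reg 3)))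
       (Then (glue_stmt 0 3 13) (glue_stmt 9 6 13))))))"

text \<open>The second and third posets are dualized and padded to a common size \<open>N\<close>;
  the first and fourth keep their order. The ground sets thus have \<open>n1 + N + 1\<close> and
  \<open>n4 + N + 1\<close> elements, where \<open>n1\<close> and \<open>n4\<close> are the sizes of
  the latter two.\<close>

fun reduction :: "pointed \<times> pointed \<times> pointed \<times> pointed \<Rightarrow> pointed \<times> pointed" where
  "reduction (a1, a2, a3, a4) =
    (let N = max (card (fst (fst a2))) (card (fst (fst a3))) in (glue a1 a2 N, glue a4 a3 N))"

lemma holds_pointed_cong:
  "holds_pointed w R d a \<Longrightarrow> (\<And>r. r < d + 3 \<Longrightarrow> R' r = R r) \<Longrightarrow> holds_pointed w R' d a"
proof -
  assume a: "holds_pointed w R d a" and R: "\<And>r. r < d + 3 \<Longrightarrow> R' r = R r"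
  have eqs: "R' d = R d" "R' (d + 1) = R (d + 1)" "R' (d + 2) = R (d + 2)" by (simp_all add: R)
  show ?thesis using a unfolding holds_pointed_def eqs .
qed

lemma printed_reduction_stmt:
  "printed (encoding QuadRLE a) reduction_stmt 0 (\<lambda>_. 0) = encoding CRLE (reduction a)"
proof -
  obtain a1 a2 a3 a4 where a: "a = (a1, a2, a3, a4)" by (metis prod.exhaust)
  define w where "w = encoding QuadRLE a"
  have w: "w = encode_pointed a1 @ encode_pointed a2 @ encode_pointed a3 @ encode_pointed a4"
    by (simp add: w_def a QuadRLE_def)
  have w1: "w = [] @ encode_pointed a1 @ (encode_pointed a2 @ encode_pointed a3 @ encode_pointed a4)" by (simp add: w)
  obtain R1 where R1: "\<And>s. printed w (parse_stmt (Num 0) 0 s) 0 (\<lambda>_. 0) = printed w s (0 + 3) R1"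
      "holds_pointed w R1 0 a1" "\<And>r. r < 0 \<Longrightarrow> R1 r = (\<lambda>_. 0) r"
      "eval w R1 (next_expr 0) = length ([] @ encode_pointed a1)"
    by (rule printed_parse_stmt[OF w1, of "\<lambda>_. 0" "Num 0" 0])
      (use that in \<open>simp_all\<close>)
  have w2: "w = encode_pointed a1 @ encode_pointed a2 @ (encode_pointed a3 @ encode_pointed a4)" by (simp add: w)
  obtain R2 where R2: "\<And>s. printed w (parse_stmt (next_expr 0) 3 s) 3 R1 = printed w s (3 + 3) R2"
      "holds_pointed w R2 3 a2" "\<And>r. r < 3 \<Longrightarrow> R2 r = R1 r"
      "eval w R2 (next_expr 3) = length (encode_pointed a1 @ encode_pointed a2)"
    by (rule printed_parse_stmt[OF w2, of R1 "(next_expr 0)" 3])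
      (use R1(4) that in \<open>simp_all add: next_expr_def\<close>)
  have w3: "w = (encode_pointed a1 @ encode_pointed a2) @ encode_pointed a3 @ encode_pointed a4" by (simp add: w)
  obtain R3 where R3: "\<And>s. printed w (parse_stmt (next_expr 3) 6 s) 6 R2 = printed w s (6 + 3) R3"
      "holds_pointed w R3 6 a3" "\<And>r. r < 6 \<Longrightarrow> R3 r = R2 r"
      "eval w R3 (next_expr 6) = length ((encode_pointed a1 @ encode_pointed a2) @ encode_pointed a3)"
    by (rule printed_parse_stmt[OF w3, of R2 "(next_expr 3)" 6])
      (use R2(4) that in \<open>simp_all add: next_expr_def\<close>)
  have w4: "w = ((encode_pointed a1 @ encode_pointed a2) @ encode_pointed a3) @ encode_pointed a4 @ []" by (simp add: w)
  obtain R4 where R4: "\<And>s. printed w (parse_stmt (next_expr 6) 9 s) 9 R3 = printed w s (9 + 3) R4"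
      "holds_pointed w R4 9 a4" "\<And>r. r < 9 \<Longrightarrow> R4 r = R3 r"
      "eval w R4 (next_expr 9) = length (((encode_pointed a1 @ encode_pointed a2) @ encode_pointed a3) @ encode_pointed a4)"
    by (rule printed_parse_stmt[OF w4, of R3 "(next_expr 6)" 9])
      (use R3(4) that in \<open>simp_all add: next_expr_def\<close>)
  define N where "N = max (card (fst (fst a2))) (card (fst (fst a3)))"
  define R5 where "R5 = R4(12 := N)"
  \<comment> \<open>Each parse writes only from its own first register upwards, so the posets read
    earlier survive.\<close>
  have holds: "holds_pointed w R5 0 a1" "holds_pointed w R5 3 a2" "holds_pointed w R5 6 a3" "holds_pointed w R5 9 a4"
    using R1(2) R2(2,3) R3(2,3) R4(2,3)
    by (auto elim!: holds_pointed_cong simp: R5_def)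
  have "R4 3 = card (fst (fst a2))" "R4 6 = card (fst (fst a3))"
    using holds by (simp_all add: holds_pointed_def R5_def)
  then have N: "eval w R4 (Plus (Reg 3) (Minus (Reg 6) (Reg 3))) = N" by (simp add: N_def)
  have "printed w reduction_stmt 0 (\<lambda>_. 0) =
      printed w (glue_stmt 0 3 13) 13 R5 @ printed w (glue_stmt 9 6 13) 13 R5"
    using R1(1) R2(1) R3(1) R4(1) N by (simp add: reduction_stmt_def R5_def)
  also have "printed w (glue_stmt 0 3 13) 13 R5 = encode_pointed (glue a1 a2 N)"
    using printed_glue_stmt[of 0 13 3 w R5 "fst (fst a1)" "snd (fst a1)" "snd a1" "fst (fst a2)" "snd (fst a2)" "snd a2" N]
      holds by (simp add: R5_def)
  also have "printed w (glue_stmt 9 6 13) 13 R5 = encode_pointed (glue a4 a3 N)"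
    using printed_glue_stmt[of 9 13 6 w R5 "fst (fst a4)" "snd (fst a4)" "snd a4" "fst (fst a3)" "snd (fst a3)" "snd a3" N]
      holds by (simp add: R5_def)
  finally show ?thesis unfolding w_def by (simp add: a CRLE_def N_def Let_def)
qed

lemma closed_reduction_stmt: "closed 0 reduction_stmt"
  by (simp add: reduction_stmt_def parse_stmt_def next_expr_def glue_stmt_def unary_stmt_def
      entry_expr_def Let_def)

lemma polytime_computable_reduction:
  "polytime_computable (instances QuadRLE) (encoding QuadRLE) (encoding CRLE) reduction"
  by (rule polytime_computable_stmt[OF closed_reduction_stmt]) (rule printed_reduction_stmt)

theorem theorem7p2:
  shows "polytime_reducible QuadRLE CRLE \<and>
    (\<exists>F. polytime_computable (instances QuadRLE) (encoding QuadRLE) (encoding CRLE) F \<and>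
      (\<forall>X1 r1 x1 X2 r2 x2 X3 r3 x3 X4 r4 x4.
        ((X1, r1), x1) \<in> pointed_posets \<longrightarrow> ((X2, r2), x2) \<in> pointed_posets \<longrightarrow>
        ((X3, r3), x3) \<in> pointed_posets \<longrightarrow> ((X4, r4), x4) \<in> pointed_posets \<longrightarrow>
        (\<exists>X r x Y s y.
          F (((X1, r1), x1), ((X2, r2), x2), ((X3, r3), x3), ((X4, r4), x4)) =
            (((X, r), x), ((Y, s), y)) \<and>
          ((X, r), x) \<in> pointed_posets \<and> ((Y, s), y) \<in> pointed_posets \<and>
          card X \<le> card X1 + max (card X2) (card X3) + 1 \<and>
          card Y \<le> card X4 + max (card X2) (card X3) + 1 \<and>
          (rho (X, r) x = rho (Y, s) y \<longleftrightarrow>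
            rho (X1, r1) x1 * rho (X2, r2) x2 = rho (X3, r3) x3 * rho (X4, r4) x4))))"
proof -
  \<comment> \<open>Both claims rest on the same function, so its properties are collected once for
    use in each.\<close>
  have main: "\<exists>X r x Y s y.
      reduction (((X1, r1), x1), ((X2, r2), x2), ((X3, r3), x3), ((X4, r4), x4)) =
        (((X, r), x), ((Y, s), y)) \<and>
      ((X, r), x) \<in> pointed_posets \<and> ((Y, s), y) \<in> pointed_posets \<and>
      card X \<le> card X1 + max (card X2) (card X3) + 1 \<and>
      card Y \<le> card X4 + max (card X2) (card X3) + 1 \<and>
      (rho (X, r) x = rho (Y, s) y \<longleftrightarrow>
        rho (X1, r1) x1 * rho (X2, r2) x2 = rho (X3, r3) x3 * rho (X4, r4) x4)"
    if "((X1, r1), x1) \<in> pointed_posets" "((X2, r2), x2) \<in> pointed_posets"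
      "((X3, r3), x3) \<in> pointed_posets" "((X4, r4), x4) \<in> pointed_posets"
    for X1 r1 x1 X2 r2 x2 X3 r3 x3 X4 r4 x4
  proof -
    define N where "N = max (card X2) (card X3)"
    have N: "card X2 \<le> N" "card X3 \<le> N" by (simp_all add: N_def)
    show ?thesis
      using glue_pointed_posets[OF that(1,2) N(1)] glue_pointed_posets[OF that(4,3) N(2)]
        rho_glue_eq_iff[OF that N glue.simps glue.simps]
      by (simp add: N_def Let_def)
  qed
  have "polytime_reduction QuadRLE CRLE reduction"
    unfolding polytime_reduction_def
  proof (intro conjI ballI polytime_computable_reduction)
    fix a assume "a \<in> instances QuadRLE"
    then obtain X1 r1 x1 X2 r2 x2 X3 r3 x3 X4 r4 x4
      where a: "a = (((X1, r1), x1), ((X2, r2), x2), ((X3, r3), x3), ((X4, r4), x4))"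
        and p: "((X1, r1), x1) \<in> pointed_posets" "((X2, r2), x2) \<in> pointed_posets"
          "((X3, r3), x3) \<in> pointed_posets" "((X4, r4), x4) \<in> pointed_posets"
      unfolding QuadRLE_def by auto
    show "reduction a \<in> instances CRLE" "reduction a \<in> yes_instances CRLE \<longleftrightarrow> a \<in> yes_instances QuadRLE"
      using main[OF p] p unfolding a by (auto simp: CRLE_def QuadRLE_def simp del: reduction.simps)
  qed
  then show ?thesis
    unfolding polytime_reducible_def using main polytime_computable_reduction by blast
qed

end
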